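(* Let $f:\mathbb R^d\to\mathbb R$ be $L$-smooth and bounded below, $\inf_x f(x)>-\infty$, and suppose the gradient oracle is unbiased with $\sigma$-sub-Gaussian noise (see context). Let $\Delta_1=f(x_1)-f_*$, where $f_*$ is any valid (finite) lower bound for $f$. Then with probability at least $1-\delta$, the iterate sequence $(x_t)_{t\ge1}$ output by AdaGrad-Norm satisfies $$\frac1T\sum_{t=1}^T\|\nabla f(x_t)\|^2\le g(\delta)\cdot O\left(\frac{\sigma}{\sqrt T}+\frac{r(\delta)}{T}\right),$$ where $$g(\delta):=O\left(\Delta_1+c(\delta)\sqrt{\log\tfrac T\delta}+L\log\big(\sigma\sqrt T+r(\delta)\big)\right),$$ $$c(\delta):=O\left(\sigma^3\log\big(\tfrac1\delta\big)+\sigma\log\big(1+\sigma^2T+\sigma^2\log\tfrac1\delta\big)+\sigma\log\big(\sigma\sqrt T+r(\delta)\big)\right),$$ $$r(\delta):=O\left(\Delta_1+\sigma^2\log\tfrac1\delta+L\log L\right)$$ are polylog terms.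
   Context: $\|\cdot\|$ is the $\ell_2$ norm on $\mathbb R^d$. $f$ is $L$-smooth: $f$ is differentiable and $\|\nabla f(x)-\nabla f(y)\|\le L\|x-y\|$ for all $x,y\in\mathbb R^d$; $f$ need not be convex and its gradients need not be bounded. The $O(\cdot)$ notation suppresses constants, including the dependence on the algorithm parameters $\eta$ and $b_0$. AdaGrad-Norm (parameters $x_1\in\mathbb R^d$, $\eta>0$, $b_0>0$): for $t=1,\dots,T$, $b_t=\sqrt{b_0^2+\sum_{i=1}^t\|\widehat\nabla f(x_i)\|^2}$ and $x_{t+1}=x_t-\frac{\eta}{b_t}\widehat\nabla f(x_t)$. Noise assumptions: a random variable $Y$ is $\sigma$-sub-Gaussian if $\mathbb E[\exp(\lambda^2Y^2)]\le\exp(\lambda^2\sigma^2)$ for all $\lambda$ with $|\lambda|\le1/\sigma$. $\widehat\nabla f(x)$ is a history-independent stochastic gradient oracle with $\mathbb E[\widehat\nabla f(x)\mid x]=\nabla f(x)$, and $\|\widehat\nabla f(x)-\nabla f(x)\|$ is $\sigma$-sub-Gaussian.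
   Formalization: The term r(δ) is taken as a constant times (1 + Δ₁ + σ² log(1/δ) + L log L), with an additive constant that depends on η and b₀; without it the bound fails when Δ₁, σ and L log L are small. *)

theory Defs
  imports "HOL-Probability.Probability"
begin

text \<open>
  The constants hidden in the \<open>O\<close>-notation must not depend on the dimension, so the dimension
  is quantified inside the statement and cannot be a type.  A point of \<open>R\<^sup>d\<close> is therefore an
  extensional function on the index set \<open>{..<d}\<close>, and \<open>Rd_borel d\<close> is the Borel
  \<open>\<sigma>\<close>-algebra of \<open>R\<^sup>d\<close>, presented as a finite product.
\<close>

definition Rd :: "nat \<Rightarrow> (nat \<Rightarrow> real) set" where
  "Rd d = ({..<d} \<rightarrow>\<^sub>E UNIV)"

definition Rd_borel :: "nat \<Rightarrow> (nat \<Rightarrow> real) measure" where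
  "Rd_borel d = (\<Pi>\<^sub>M i\<in>{..<d}. borel)"

definition Rd_norm :: "nat \<Rightarrow> (nat \<Rightarrow> real) \<Rightarrow> real" where
  "Rd_norm d x = L2_set x {..<d}"

definition Rd_dist :: "nat \<Rightarrow> (nat \<Rightarrow> real) \<Rightarrow> (nat \<Rightarrow> real) \<Rightarrow> real" where
  "Rd_dist d x y = Rd_norm d (\<lambda>i. x i - y i)"

text \<open>Frechet differentiability at \<open>x\<close> with gradient \<open>v\<close>.\<close>

definition has_gradient ::
  "nat \<Rightarrow> ((nat \<Rightarrow> real) \<Rightarrow> real) \<Rightarrow> (nat \<Rightarrow> real) \<Rightarrow> (nat \<Rightarrow> real) \<Rightarrow> bool" where
  "has_gradient d f v x \<longleftrightarrow>
     (\<forall>\<epsilon>>0. \<exists>\<rho>>0. \<forall>y\<in>Rd d. Rd_dist d y x < \<rho> \<longrightarrow>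
        \<bar>f y - f x - (\<Sum>i<d. v i * (y i - x i))\<bar> \<le> \<epsilon> * Rd_dist d y x)"

definition L_smooth ::
  "nat \<Rightarrow> real \<Rightarrow> ((nat \<Rightarrow> real) \<Rightarrow> real) \<Rightarrow> ((nat \<Rightarrow> real) \<Rightarrow> (nat \<Rightarrow> real)) \<Rightarrow> bool" where
  "L_smooth d L f gradf \<longleftrightarrow>
     (\<forall>x\<in>Rd d. gradf x \<in> Rd d \<and> has_gradient d f (gradf x) x) \<and>
     (\<forall>x\<in>Rd d. \<forall>y\<in>Rd d. Rd_dist d (gradf x) (gradf y) \<le> L * Rd_dist d x y)"

text \<open>
  Integrability is required explicitly because the Bochner integral of a non-integrable function
  is \<open>0\<close>.  The definition is meant for \<open>\<sigma> > 0\<close>.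
\<close>

definition sub_gaussian :: "'z measure \<Rightarrow> real \<Rightarrow> ('z \<Rightarrow> real) \<Rightarrow> bool" where
  "sub_gaussian D \<sigma> Y \<longleftrightarrow>
     Y \<in> borel_measurable D \<and>
     (\<forall>l::real. \<bar>l\<bar> \<le> 1 / \<sigma> \<longrightarrow>
        integrable D (\<lambda>z. exp (l\<^sup>2 * (Y z)\<^sup>2)) \<and>
        (\<integral>z. exp (l\<^sup>2 * (Y z)\<^sup>2) \<partial>D) \<le> exp (l\<^sup>2 * \<sigma>\<^sup>2))"

text \<open>
  A query at \<open>x\<close> draws a fresh sample \<open>z\<close> from \<open>D\<close> and returns \<open>G x z\<close>; the law of the answer
  depends on \<open>x\<close> only.
\<close>

definition gradient_oracle ::
  "nat \<Rightarrow> ((nat \<Rightarrow> real) \<Rightarrow> (nat \<Rightarrow> real)) \<Rightarrow> real \<Rightarrow> 'z measure \<Rightarrow>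
     ((nat \<Rightarrow> real) \<Rightarrow> 'z \<Rightarrow> (nat \<Rightarrow> real)) \<Rightarrow> bool" where
  "gradient_oracle d gradf \<sigma> D G \<longleftrightarrow>
     prob_space D \<and>
     (\<lambda>(x, z). G x z) \<in> (Rd_borel d \<Otimes>\<^sub>M D) \<rightarrow>\<^sub>M Rd_borel d \<and>
     (\<forall>x\<in>Rd d.
        (\<forall>i<d. integrable D (\<lambda>z. G x z i) \<and> (\<integral>z. G x z i \<partial>D) = gradf x i) \<and>
        sub_gaussian D \<sigma> (\<lambda>z. Rd_dist d (G x z) (gradf x)))"

definition iid_samples ::
  "'w measure \<Rightarrow> 'z measure \<Rightarrow> nat set \<Rightarrow> (nat \<Rightarrow> 'w \<Rightarrow> 'z) \<Rightarrow> bool" where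
  "iid_samples M D I \<zeta> \<longleftrightarrow>
     prob_space M \<and> prob_space.indep_vars M (\<lambda>_. D) \<zeta> I \<and> (\<forall>t\<in>I. distr M D (\<zeta> t) = D)"

text \<open>
  \<open>ghat t\<close> is the stochastic gradient received at \<open>x t\<close>; times start at \<open>1\<close>.
\<close>

definition adagrad_b :: "nat \<Rightarrow> real \<Rightarrow> (nat \<Rightarrow> (nat \<Rightarrow> real)) \<Rightarrow> nat \<Rightarrow> real" where
  "adagrad_b d b0 ghat t = sqrt (b0\<^sup>2 + (\<Sum>i=1..t. (Rd_norm d (ghat i))\<^sup>2))"

definition adagrad_norm_run ::
  "nat \<Rightarrow> real \<Rightarrow> real \<Rightarrow> (nat \<Rightarrow> real) \<Rightarrow> nat \<Rightarrow> (nat \<Rightarrow> (nat \<Rightarrow> real)) \<Rightarrow> (nat \<Rightarrow> (nat \<Rightarrow> real)) \<Rightarrow> bool"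
  where
  "adagrad_norm_run d \<eta> b0 x1 T ghat x \<longleftrightarrow>
     x 1 = x1 \<and>
     (\<forall>t\<in>{1..T}. x (t + 1) = (\<lambda>i\<in>{..<d}. x t i - \<eta> / adagrad_b d b0 ghat t * ghat t i))"

text \<open>
  The three polylog terms, with the constant hidden in each \<open>O\<close> as first argument.  The
  quantity \<open>r(\<delta>)\<close> is an upper bound, up to a multiple of \<open>\<sigma> \<surd>T\<close>, for the step-size denominator
  \<open>b\<^sub>T \<ge> b\<^sub>0\<close>; the summand \<open>1\<close> is the additive constant (depending on \<open>b\<^sub>0\<close> and \<open>\<eta>\<close>) that its
  \<open>O\<close> suppresses.  Without it the remaining sum, in which \<open>L log L\<close> may be negative, need not
  be positive, and the bound fails when \<open>\<Delta>\<^sub>1\<close>, \<open>L\<close> and \<open>\<sigma>\<close> are small.  No such constant is added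
  in the other \<open>O\<close>s.
\<close>

definition r_term :: "real \<Rightarrow> real \<Rightarrow> real \<Rightarrow> real \<Rightarrow> real \<Rightarrow> real" where
  "r_term C \<Delta>\<^sub>1 L \<sigma> \<delta> = C * (1 + \<Delta>\<^sub>1 + \<sigma>\<^sup>2 * ln (1 / \<delta>) + L * ln L)"

definition c_term :: "real \<Rightarrow> real \<Rightarrow> real \<Rightarrow> nat \<Rightarrow> real \<Rightarrow> real" where
  "c_term C r \<sigma> T \<delta> =
     C * (\<sigma> ^ 3 * ln (1 / \<delta>) + \<sigma> * ln (1 + \<sigma>\<^sup>2 * real T + \<sigma>\<^sup>2 * ln (1 / \<delta>))
          + \<sigma> * ln (\<sigma> * sqrt (real T) + r))"

definition g_term :: "real \<Rightarrow> real \<Rightarrow> real \<Rightarrow> real \<Rightarrow> real \<Rightarrow> real \<Rightarrow> nat \<Rightarrow> real \<Rightarrow> real" where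
  "g_term C r c \<Delta>\<^sub>1 L \<sigma> T \<delta> =
     C * (\<Delta>\<^sub>1 + c * sqrt (ln (real T / \<delta>)) + L * ln (\<sigma> * sqrt (real T) + r))"

end

theory Submission
  imports Defs
begin

text \<open>
  By the descent inequality, a step of the algorithm changes the objective by at most
  \<open>- \<eta> s / b + L \<eta>\<^sup>2 q\<^sup>2 / (2 b\<^sup>2)\<close>, where \<open>s\<close> is the inner product of the gradient with the stochastic
  gradient, \<open>q\<close> is the norm of the latter and \<open>b\<close> is the current denominator.  The second-order
  terms add up to a logarithm of \<open>b\<close>.  If \<open>s\<close> were the squared gradient norm \<open>p\<^sup>2\<close>, this would bound
  the sum of \<open>p\<^sup>2 / b\<close>, and a bound on the last denominator would bound the sum of \<open>p\<^sup>2\<close>.  There are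
  two obstacles: \<open>b\<close> depends on the same noise as \<open>s\<close>, and \<open>b\<close> is itself random and unbounded.

  The last denominator is bounded by a multiple of \<open>\<sigma> \<surd>T + r\<close> (lemma \<open>step_size_implicit_bound\<close> and
  lemma \<open>step_size_le\<close>).  The increments of \<open>b\<close> are paid for by the decrease of the objective and by
  the noise, as long as \<open>b\<^sup>2\<close> dominates the accumulated squared noise.  A martingale bound shows that
  this can fail only while \<open>b\<^sup>2\<close> is at most of order \<open>\<sigma>\<^sup>2 ln (4 / \<delta>)\<close>.  The first-order terms
  increase the objective during this initial phase by at most the order of \<open>\<sigma>\<^sup>2 ln (4 / \<delta>)\<close>, but
  also at most the order of \<open>\<sigma> sqrt (T ln (4 / \<delta>))\<close>.  Using the first bound for small \<open>\<delta>\<close> and the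
  second for \<open>\<delta>\<close> near \<open>1\<close> turns \<open>ln (4 / \<delta>)\<close> into \<open>ln (1 / \<delta>)\<close>.

  The sum of \<open>p\<^sup>2\<close> is then bounded by replacing \<open>b\<close> with the predictable denominator
  \<open>a = sqrt (b\<^sup>2 + p\<^sup>2 + m\<^sup>2)\<close>, with \<open>b\<close> taken before the step and \<open>m\<close> of order \<open>\<sigma> sqrt (ln (T / \<delta>))\<close>
  a uniform bound on the noise (lemma \<open>gradient_sum_bound\<close>).  The replacement costs a fraction of the
  sum of \<open>p\<^sup>2 / a\<close> and \<open>m\<close> times a logarithm, and the noise term is now a martingale whose
  variance, suitably scaled, is again a fraction of the sum of \<open>p\<^sup>2 / a\<close>.  Hence that sum is at most of
  order \<open>\<Delta>\<^sub>1 + (L + m) ln (\<sigma> \<surd>T + r)\<close>.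
  This is at most a multiple of \<open>g\<close>, as \<open>c\<close> is at least a multiple of \<open>\<sigma> ln (\<sigma> \<surd>T + r)\<close>, and the
  factor \<open>max a\<close>, of order \<open>\<sigma> \<surd>T + r\<close>, leads to the sum of \<open>p\<^sup>2\<close>.  That \<open>m\<close> has order
  \<open>\<sigma> sqrt (ln (T / \<delta>))\<close> presupposes \<open>T \<ge> 2\<close>; a single step is covered by the inequality between
  squared gradient and function value (lemma \<open>gradient_sq_le_gap\<close>).

  All random estimates are instances of Ville's inequality (lemma \<open>fresh_factors_maximal\<close>), with
  exponential moments supplied by the sub-Gaussian assumption (lemma \<open>sub_gaussian_linear_mgf\<close>).  They
  are carried out on the product space of the samples, on which the iterates are explicit functions.
\<close>

section \<open>Exponential moments and a maximal inequality\<close>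

lemma exp_le_add_exp_square: "exp x \<le> x + exp (x\<^sup>2)" for x :: real
proof -
  have quad: "1 + x\<^sup>2 \<le> exp (x\<^sup>2)" by (rule exp_ge_add_one_self)
  consider "x \<le> 0" | "0 \<le> x" "x \<le> 1" | "1 < x" by linarith
  then show ?thesis
  proof cases
    case 1
    have "1 \<le> (1 - x) * (1 + x + x\<^sup>2)"
    proof -
      have "(1 - x) * (1 + x + x\<^sup>2) = 1 + (- x) ^ 3"
        by (simp add: algebra_simps power2_eq_square power3_eq_cube)
      then show ?thesis using 1 by simp
    qed
    also have "\<dots> \<le> exp (- x) * (1 + x + x\<^sup>2)"
    proof (rule mult_right_mono)
      show "1 - x \<le> exp (- x)" using exp_ge_add_one_self[of "- x"] by simp
      have "0 \<le> (1 + x / 2)\<^sup>2 + 3 / 4 * x\<^sup>2" by simp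
      then show "0 \<le> 1 + x + x\<^sup>2" by (simp add: power2_eq_square algebra_simps)
    qed
    finally have "exp x \<le> 1 + x + x\<^sup>2" by (simp add: exp_minus field_simps)
    with quad show ?thesis by linarith
  next
    case 2
    with exp_bound[of x] quad show ?thesis by linarith
  next
    case 3
    then have "x \<le> x\<^sup>2" by (simp add: power2_eq_square)
    then have "exp x \<le> exp (x\<^sup>2)" by simp
    with 3 show ?thesis by linarith
  qed
qed

text \<open>
  For \<open>l \<sigma> \<le> 1\<close> the linear term of \<open>exp x \<le> x + exp (x\<^sup>2)\<close> integrates
  to zero.  For larger \<open>l\<close> the crude inequality \<open>2 l y \<le> l\<^sup>2 \<sigma>\<^sup>2 + y\<^sup>2 / \<sigma>\<^sup>2\<close> is enough, because
  \<open>1 / 2 \<le> l\<^sup>2 \<sigma>\<^sup>2 / 2\<close> leaves room for the moment of \<open>y\<^sup>2 / (2 \<sigma>\<^sup>2)\<close>.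
\<close>

lemma sub_gaussian_linear_mgf:
  assumes D: "prob_space D" and \<sigma>: "\<sigma> > 0" and sg: "sub_gaussian D \<sigma> Y"
    and X: "integrable D X" "(\<integral>z. X z \<partial>D) = 0"
    and XY: "\<And>z. z \<in> space D \<Longrightarrow> \<bar>X z\<bar> \<le> l * Y z" and l: "l \<ge> 0"
  shows "(\<integral>\<^sup>+z. ennreal (exp (X z - l\<^sup>2 * \<sigma>\<^sup>2)) \<partial>D) \<le> 1"
proof -
  interpret prob_space D by (rule D)
  have meas[measurable]: "X \<in> borel_measurable D" "Y \<in> borel_measurable D"
    using X sg by (auto simp: sub_gaussian_def)
  have *: "(\<integral>\<^sup>+z. ennreal (exp (X z - l\<^sup>2 * \<sigma>\<^sup>2)) \<partial>D) \<le> 1"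
    if H: "integrable D H" "(\<integral>z. H z \<partial>D) \<le> exp (l\<^sup>2 * \<sigma>\<^sup>2)"
      and le: "\<And>z. z \<in> space D \<Longrightarrow> exp (X z) \<le> H z" for H
  proof -
    have "(\<integral>\<^sup>+z. ennreal (exp (X z - l\<^sup>2 * \<sigma>\<^sup>2)) \<partial>D)
        \<le> (\<integral>\<^sup>+z. ennreal (H z * exp (- (l\<^sup>2 * \<sigma>\<^sup>2))) \<partial>D)"
      using le by (intro nn_integral_mono ennreal_leI)
        (auto simp: exp_diff exp_minus divide_inverse intro!: mult_right_mono)
    also have "\<dots> = ennreal (\<integral>z. H z * exp (- (l\<^sup>2 * \<sigma>\<^sup>2)) \<partial>D)"
    proof (intro nn_integral_eq_integral AE_I2)
      fix z assume "z \<in> space D"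
      then have "0 \<le> H z" using le[of z] exp_ge_zero[of "X z"] by linarith
      then show "0 \<le> H z * exp (- (l\<^sup>2 * \<sigma>\<^sup>2))" by simp
    qed (use H in simp)
    also have "\<dots> \<le> 1"
      using H(2) by (simp add: exp_minus field_simps ennreal_le_1)
    finally show ?thesis .
  qed
  show ?thesis
  proof (cases "l \<le> 1 / \<sigma>")
    case True
    then have int: "integrable D (\<lambda>z. exp (l\<^sup>2 * (Y z)\<^sup>2))"
      and le: "(\<integral>z. exp (l\<^sup>2 * (Y z)\<^sup>2) \<partial>D) \<le> exp (l\<^sup>2 * \<sigma>\<^sup>2)"
      using sg l by (auto simp: sub_gaussian_def)
    show ?thesis
    proof (rule *[of "\<lambda>z. X z + exp (l\<^sup>2 * (Y z)\<^sup>2)"])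
      fix z assume z: "z \<in> space D"
      have "(X z)\<^sup>2 \<le> (l * Y z)\<^sup>2"
        using order_trans[OF XY[OF z] abs_ge_self] by (simp only: abs_le_square_iff)
      then show "exp (X z) \<le> X z + exp (l\<^sup>2 * (Y z)\<^sup>2)"
        using exp_le_add_exp_square[of "X z"] by (simp add: power_mult_distrib order_trans)
    qed (use int le X in auto)
  next
    case False
    define k where "k = 1 / (sqrt 2 * \<sigma>)"
    have k2: "k\<^sup>2 = 1 / (2 * \<sigma>\<^sup>2)" by (simp add: k_def power_mult_distrib power_divide)
    have "1 / (sqrt 2 * \<sigma>) \<le> 1 / \<sigma>" using \<sigma> by (intro divide_left_mono) auto
    then have "\<bar>k\<bar> \<le> 1 / \<sigma>" using \<sigma> by (simp add: k_def)
    then have int: "integrable D (\<lambda>z. exp (k\<^sup>2 * (Y z)\<^sup>2))"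
      and le: "(\<integral>z. exp (k\<^sup>2 * (Y z)\<^sup>2) \<partial>D) \<le> exp (k\<^sup>2 * \<sigma>\<^sup>2)"
      using sg by (auto simp: sub_gaussian_def)
    have "1 < l * \<sigma>" using False \<sigma> by (simp add: field_simps)
    then have "1 \<le> (l * \<sigma>)\<^sup>2" by (simp add: one_le_power)
    then have big: "1 / 2 \<le> l\<^sup>2 * \<sigma>\<^sup>2 / 2" by (simp add: power_mult_distrib)
    show ?thesis
    proof (rule *[of "\<lambda>z. exp (l\<^sup>2 * \<sigma>\<^sup>2 / 2) * exp (k\<^sup>2 * (Y z)\<^sup>2)"])
      have "(\<integral>z. exp (l\<^sup>2 * \<sigma>\<^sup>2 / 2) * exp (k\<^sup>2 * (Y z)\<^sup>2) \<partial>D) \<le> exp (l\<^sup>2 * \<sigma>\<^sup>2 / 2) * exp (k\<^sup>2 * \<sigma>\<^sup>2)"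
        using le by simp
      also have "\<dots> \<le> exp (l\<^sup>2 * \<sigma>\<^sup>2)"
        using big \<sigma> by (simp add: exp_add[symmetric] k2)
      finally show "(\<integral>z. exp (l\<^sup>2 * \<sigma>\<^sup>2 / 2) * exp (k\<^sup>2 * (Y z)\<^sup>2) \<partial>D) \<le> exp (l\<^sup>2 * \<sigma>\<^sup>2)" .
    next
      fix z assume z: "z \<in> space D"
      have "0 \<le> (l * \<sigma> - Y z / \<sigma>)\<^sup>2" by simp
      then have "2 * (l * Y z) \<le> l\<^sup>2 * \<sigma>\<^sup>2 + (Y z)\<^sup>2 / \<sigma>\<^sup>2"
        using \<sigma> by (simp add: power2_diff power_mult_distrib power_divide)
      then have "X z \<le> l\<^sup>2 * \<sigma>\<^sup>2 / 2 + k\<^sup>2 * (Y z)\<^sup>2"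
        using XY[OF z] by (simp add: k2 abs_le_iff)
      then show "exp (X z) \<le> exp (l\<^sup>2 * \<sigma>\<^sup>2 / 2) * exp (k\<^sup>2 * (Y z)\<^sup>2)"
        by (simp add: exp_add[symmetric])
    qed (use int in simp)
  qed
qed

lemma sub_gaussian_square_mgf:
  assumes D: "prob_space D" and \<sigma>: "\<sigma> > 0" and sg: "sub_gaussian D \<sigma> Y"
  shows "(\<integral>\<^sup>+z. ennreal (exp ((Y z)\<^sup>2 / \<sigma>\<^sup>2 - 1)) \<partial>D) \<le> 1"
proof -
  have "\<bar>1 / \<sigma>\<bar> \<le> 1 / \<sigma>" using \<sigma> by simp
  then have int: "integrable D (\<lambda>z. exp ((1 / \<sigma>)\<^sup>2 * (Y z)\<^sup>2))"
    and le: "(\<integral>z. exp ((1 / \<sigma>)\<^sup>2 * (Y z)\<^sup>2) \<partial>D) \<le> exp ((1 / \<sigma>)\<^sup>2 * \<sigma>\<^sup>2)"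
    using sg unfolding sub_gaussian_def by blast+
  have "(\<integral>\<^sup>+z. ennreal (exp ((Y z)\<^sup>2 / \<sigma>\<^sup>2 - 1)) \<partial>D)
      = (\<integral>\<^sup>+z. ennreal (exp ((1 / \<sigma>)\<^sup>2 * (Y z)\<^sup>2) * exp (- 1)) \<partial>D)"
    by (simp add: exp_diff exp_minus divide_inverse power_mult_distrib power_inverse mult.commute)
  also have "\<dots> = ennreal (\<integral>z. exp ((1 / \<sigma>)\<^sup>2 * (Y z)\<^sup>2) * exp (- 1) \<partial>D)"
    using int by (intro nn_integral_eq_integral) auto
  also have "\<dots> \<le> 1"
    using le \<sigma> by (simp add: exp_minus field_simps ennreal_le_1)
  finally show ?thesis .
qed

text \<open>
  The log-increments of a supermartingale on a finite product space: \<open>\<psi> t\<close> looks at the samples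
  \<open>1, \<dots>, t + 1\<close> only, and \<open>exp (\<psi> t)\<close> has mean at most \<open>1\<close> when sample \<open>t + 1\<close> is drawn afresh
  and the earlier ones are held fixed.
\<close>

definition fresh_factors ::
  "'z measure \<Rightarrow> nat \<Rightarrow> (nat \<Rightarrow> (nat \<Rightarrow> 'z) \<Rightarrow> real) \<Rightarrow> bool" where
  "fresh_factors D T \<psi> \<longleftrightarrow>
     (\<forall>t m. t < m \<longrightarrow> m \<le> T \<longrightarrow> \<psi> t \<in> borel_measurable (\<Pi>\<^sub>M i\<in>{1..m}. D)) \<and>
     (\<forall>t k z y. Suc t < k \<longrightarrow> \<psi> t (z(k := y)) = \<psi> t z) \<and>
     (\<forall>t<T. \<forall>z \<in> space (\<Pi>\<^sub>M i\<in>{1..t}. D). (\<integral>\<^sup>+y. ennreal (exp (\<psi> t (z(Suc t := y)))) \<partial>D) \<le> 1)"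

text \<open>
  Integrating out the last sample first removes the last factor.
\<close>

lemma fresh_factors_exp_sum:
  assumes D: "prob_space D" and \<psi>: "fresh_factors D T \<psi>" and "m \<le> T"
  shows "(\<integral>\<^sup>+z. ennreal (exp (\<Sum>t<m. \<psi> t z)) \<partial>(\<Pi>\<^sub>M i\<in>{1..m}. D)) \<le> 1"
  using \<open>m \<le> T\<close>
proof (induction m)
  case 0
  interpret prob_space "Pi\<^sub>M {} (\<lambda>_::nat. D)" by (intro prob_space_PiM D)
  show ?case using emeasure_space_1 by simp
next
  case (Suc m)
  interpret D: prob_space D by (rule D)
  interpret product_sigma_finite "\<lambda>_::nat. D" by standard
  have [measurable]: "\<And>t. t < Suc m \<Longrightarrow> \<psi> t \<in> borel_measurable (\<Pi>\<^sub>M i\<in>{1..Suc m}. D)"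
    using \<psi> Suc.prems unfolding fresh_factors_def by blast
  have ins: "{1..Suc m} = insert (Suc m) {1..m}" by auto
  have local: "(\<Sum>t<Suc m. \<psi> t (z(Suc m := y))) = (\<Sum>t<m. \<psi> t z) + \<psi> m (z(Suc m := y))" for z y
  proof -
    have "(\<Sum>t<m. \<psi> t (z(Suc m := y))) = (\<Sum>t<m. \<psi> t z)"
      using \<psi> unfolding fresh_factors_def by (intro sum.cong) auto
    then show ?thesis by simp
  qed
  have "(\<integral>\<^sup>+z. ennreal (exp (\<Sum>t<Suc m. \<psi> t z)) \<partial>(\<Pi>\<^sub>M i\<in>{1..Suc m}. D))
      = (\<integral>\<^sup>+z. (\<integral>\<^sup>+y. ennreal (exp (\<Sum>t<Suc m. \<psi> t (z(Suc m := y)))) \<partial>D) \<partial>(\<Pi>\<^sub>M i\<in>{1..m}. D))"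
    unfolding ins
  proof (rule product_nn_integral_insert)
    show "(\<lambda>z. ennreal (exp (\<Sum>t<Suc m. \<psi> t z)))
        \<in> borel_measurable (Pi\<^sub>M (insert (Suc m) {1..m}) (\<lambda>_. D))"
      unfolding ins[symmetric] by measurable
  qed auto
  also have "\<dots> \<le> (\<integral>\<^sup>+z. ennreal (exp (\<Sum>t<m. \<psi> t z)) \<partial>(\<Pi>\<^sub>M i\<in>{1..m}. D))"
  proof (rule nn_integral_mono)
    fix z assume z: "z \<in> space (\<Pi>\<^sub>M i\<in>{1..m}. D)"
    have "\<psi> m \<in> borel_measurable (\<Pi>\<^sub>M i\<in>insert (Suc m) {1..m}. D)"
      unfolding ins[symmetric] by measurable
    moreover have "(\<lambda>y. z(Suc m := y)) \<in> measurable D (\<Pi>\<^sub>M i\<in>insert (Suc m) {1..m}. D)"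
      using z by (intro measurable_fun_upd[where J="{1..m}"]) auto
    ultimately have [measurable]: "(\<lambda>y. \<psi> m (z(Suc m := y))) \<in> borel_measurable D"
      using measurable_comp[of "\<lambda>y. z(Suc m := y)" D _ "\<psi> m" borel] by (simp add: comp_def)
    have "(\<integral>\<^sup>+y. ennreal (exp (\<Sum>t<Suc m. \<psi> t (z(Suc m := y)))) \<partial>D)
        = (\<integral>\<^sup>+y. ennreal (exp (\<Sum>t<m. \<psi> t z)) * ennreal (exp (\<psi> m (z(Suc m := y)))) \<partial>D)"
      by (simp add: local exp_add ennreal_mult' del: sum.lessThan_Suc)
    also have "\<dots> = ennreal (exp (\<Sum>t<m. \<psi> t z)) * (\<integral>\<^sup>+y. ennreal (exp (\<psi> m (z(Suc m := y)))) \<partial>D)"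
      by (rule nn_integral_cmult) measurable
    also have "\<dots> \<le> ennreal (exp (\<Sum>t<m. \<psi> t z)) * 1"
      using \<psi> z Suc.prems unfolding fresh_factors_def by (intro mult_left_mono) auto
    finally show "(\<integral>\<^sup>+y. ennreal (exp (\<Sum>t<Suc m. \<psi> t (z(Suc m := y)))) \<partial>D)
        \<le> ennreal (exp (\<Sum>t<m. \<psi> t z))" by simp
  qed
  also have "\<dots> \<le> 1" using Suc by simp
  finally show ?case .
qed

text \<open>
  Ville's maximal inequality.  Setting the increments to zero after the first crossing of the level
  gives increments of the same kind, and the stopped sum still exceeds the level at the end, so
  Markov's inequality for the final time covers all times.
\<close>

lemma fresh_factors_maximal:
  assumes D: "prob_space D" and \<psi>: "fresh_factors D T \<psi>" and eps: "\<epsilon> > 0"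
  defines "N \<equiv> \<Pi>\<^sub>M i\<in>{1..T}. D"
  defines "E \<equiv> {z \<in> space N. \<exists>k\<le>T. ln (1 / \<epsilon>) < (\<Sum>t<k. \<psi> t z)}"
  shows "E \<in> sets N" and "measure N E \<le> \<epsilon>"
proof -
  interpret N: prob_space N unfolding N_def by (intro prob_space_PiM D)
  have meas[measurable]: "\<psi> t \<in> borel_measurable N" if "t < T" for t
    using \<psi> that unfolding fresh_factors_def N_def by blast
  have [measurable]: "(\<lambda>z. \<Sum>t<k. \<psi> t z) \<in> borel_measurable N" if "k \<le> T" for k
    using that by (intro borel_measurable_sum meas) auto
  have "E = (\<Union>k\<in>{..T}. {z \<in> space N. ln (1 / \<epsilon>) < (\<Sum>t<k. \<psi> t z)})"
    unfolding E_def by auto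
  also have "\<dots> \<in> sets N" by (intro sets.finite_UN) auto
  finally show E: "E \<in> sets N" .
  define stop where "stop t z \<longleftrightarrow> (\<exists>k\<le>t. ln (1 / \<epsilon>) < (\<Sum>j<k. \<psi> j z))" for t z
  define \<phi> where "\<phi> t z = (if stop t z then 0 else \<psi> t z)" for t z
  have stop_local: "stop t (z(k := y)) = stop t z" if "t < k" for t k z y
  proof -
    have "(\<Sum>j<i. \<psi> j (z(k := y))) = (\<Sum>j<i. \<psi> j z)" if "i \<le> t" for i
      using \<psi> that \<open>t < k\<close> unfolding fresh_factors_def by (intro sum.cong) auto
    then show ?thesis unfolding stop_def by auto
  qed
  have \<phi>: "fresh_factors D T \<phi>"
    unfolding fresh_factors_def
  proof (intro conjI allI impI ballI)
    fix t m assume tm: "t < m" "m \<le> T"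
    let ?N = "\<Pi>\<^sub>M i\<in>{1..m}. D"
    have m1[measurable]: "\<psi> j \<in> borel_measurable ?N" if "j < m" for j
      using \<psi> that tm unfolding fresh_factors_def by blast
    have m2[measurable]: "(\<lambda>z. \<Sum>j<k. \<psi> j z) \<in> borel_measurable ?N" if "k \<le> t" for k
      using that tm by (intro borel_measurable_sum m1) auto
    have "Measurable.pred ?N (\<lambda>z. \<exists>k\<in>{..t}. ln (1 / \<epsilon>) < (\<Sum>j<k. \<psi> j z))"
    proof (intro pred_intros_finite)
      fix k assume "k \<in> {..t}"
      then have [measurable]: "(\<lambda>z. \<Sum>j<k. \<psi> j z) \<in> borel_measurable ?N" by (intro m2) auto
      show "Measurable.pred ?N (\<lambda>z. ln (1 / \<epsilon>) < (\<Sum>j<k. \<psi> j z))" by measurable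
    qed simp
    moreover have "(\<lambda>z. \<exists>k\<in>{..t}. ln (1 / \<epsilon>) < (\<Sum>j<k. \<psi> j z)) = stop t"
      by (auto simp: stop_def fun_eq_iff)
    ultimately have [measurable]: "Measurable.pred ?N (stop t)" by simp
    show "\<phi> t \<in> borel_measurable ?N" unfolding \<phi>_def using m1[OF tm(1)] by measurable
  next
    fix t k z y assume tk: "Suc t < k"
    then show "\<phi> t (z(k := y)) = \<phi> t z"
      using \<psi> stop_local[of t k z y] unfolding fresh_factors_def \<phi>_def by auto
  next
    fix t z assume t: "t < T" and z: "z \<in> space (\<Pi>\<^sub>M i\<in>{1..t}. D)"
    show "(\<integral>\<^sup>+y. ennreal (exp (\<phi> t (z(Suc t := y)))) \<partial>D) \<le> 1"
    proof (cases "stop t z")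
      case True
      then show ?thesis
        using prob_space.emeasure_space_1[OF D] by (simp add: \<phi>_def stop_local)
    next
      case False
      then show ?thesis using \<psi> t z by (simp add: \<phi>_def stop_local fresh_factors_def)
    qed
  qed
  have cross: "ln (1 / \<epsilon>) < (\<Sum>t<m. \<phi> t z)" if "stop m z" for m z
    using that
  proof (induction m)
    case (Suc m)
    show ?case
    proof (cases "stop m z")
      case True
      with Suc show ?thesis by (simp add: \<phi>_def)
    next
      case False
      have "(\<Sum>t<m. \<phi> t z) = (\<Sum>t<m. \<psi> t z)"
      proof (intro sum.cong refl)
        fix t assume "t \<in> {..<m}"
        then have "\<not> stop t z" using False unfolding stop_def
          by (meson lessThan_iff less_imp_le order_trans)
        then show "\<phi> t z = \<psi> t z" by (simp add: \<phi>_def)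
      qed
      moreover have "ln (1 / \<epsilon>) < (\<Sum>t<Suc m. \<psi> t z)"
        using Suc.prems False unfolding stop_def by (metis le_Suc_eq)
      ultimately show ?thesis using False by (simp add: \<phi>_def)
    qed
  qed (simp add: stop_def)
  have [measurable]: "\<And>t. t < T \<Longrightarrow> \<phi> t \<in> borel_measurable N"
    using \<phi> unfolding fresh_factors_def N_def by blast
  have u[measurable]: "(\<lambda>z. ennreal (exp (\<Sum>t<T. \<phi> t z))) \<in> borel_measurable N" by measurable
  have "emeasure N E \<le> emeasure N {z \<in> space N. 1 \<le> ennreal \<epsilon> * ennreal (exp (\<Sum>t<T. \<phi> t z))}"
  proof (rule emeasure_mono)
    show "E \<subseteq> {z \<in> space N. 1 \<le> ennreal \<epsilon> * ennreal (exp (\<Sum>t<T. \<phi> t z))}"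
    proof
      fix z assume z: "z \<in> E"
      then have "ln (1 / \<epsilon>) < (\<Sum>t<T. \<phi> t z)" using cross[of T z] unfolding E_def stop_def by auto
      then have "exp (ln (1 / \<epsilon>)) < exp (\<Sum>t<T. \<phi> t z)" by simp
      then have "1 \<le> \<epsilon> * exp (\<Sum>t<T. \<phi> t z)" using eps by (simp add: field_simps)
      then show "z \<in> {z \<in> space N. 1 \<le> ennreal \<epsilon> * ennreal (exp (\<Sum>t<T. \<phi> t z))}"
        using z eps unfolding E_def by (simp add: ennreal_mult'[symmetric])
    qed
  qed measurable
  also have "\<dots> \<le> ennreal \<epsilon> * (\<integral>\<^sup>+z. ennreal (exp (\<Sum>t<T. \<phi> t z)) * indicator (space N) z \<partial>N)"
    by (rule nn_integral_Markov_inequality) auto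
  also have "(\<integral>\<^sup>+z. ennreal (exp (\<Sum>t<T. \<phi> t z)) * indicator (space N) z \<partial>N)
      = (\<integral>\<^sup>+z. ennreal (exp (\<Sum>t<T. \<phi> t z)) \<partial>N)"
    by (intro nn_integral_cong) auto
  also have "ennreal \<epsilon> * \<dots> \<le> ennreal \<epsilon> * 1"
    using fresh_factors_exp_sum[OF D \<phi> order_refl] unfolding N_def by (intro mult_left_mono) auto
  finally show "measure N E \<le> \<epsilon>"
    using eps by (simp add: N.emeasure_eq_measure)
qed

section \<open>Smooth functions on coordinate space\<close>

lemma Rd_norm_nonneg: "Rd_norm d v \<ge> 0"
  by (simp add: Rd_norm_def)

lemma Rd_norm_sq: "(Rd_norm d v)\<^sup>2 = (\<Sum>i<d. (v i)\<^sup>2)"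
  by (simp add: Rd_norm_def L2_set_def sum_nonneg)

lemma Rd_inner_le: "\<bar>\<Sum>i<d. u i * v i\<bar> \<le> Rd_norm d u * Rd_norm d v"
proof -
  have "\<bar>\<Sum>i<d. u i * v i\<bar> \<le> (\<Sum>i<d. \<bar>u i\<bar> * \<bar>v i\<bar>)"
    using sum_abs[of "\<lambda>i. u i * v i"] by (simp add: abs_mult)
  also have "\<dots> \<le> Rd_norm d u * Rd_norm d v"
    unfolding Rd_norm_def by (rule L2_set_mult_ineq)
  finally show ?thesis .
qed

lemma Rd_norm_scale: "Rd_norm d (\<lambda>i. c * v i) = \<bar>c\<bar> * Rd_norm d v"
proof (rule power2_eq_imp_eq)
  show "(Rd_norm d (\<lambda>i. c * v i))\<^sup>2 = (\<bar>c\<bar> * Rd_norm d v)\<^sup>2"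
    unfolding power_mult_distrib Rd_norm_sq by (simp add: sum_distrib_left)
qed (simp_all add: Rd_norm_nonneg)

lemma Rd_norm_cong: "(\<And>i. i < d \<Longrightarrow> u i = v i) \<Longrightarrow> Rd_norm d u = Rd_norm d v"
  unfolding Rd_norm_def by (rule L2_set_cong) auto

lemma restrict_in_Rd: "(\<lambda>i\<in>{..<d}. v i) \<in> Rd d"
  by (simp add: Rd_def)

lemma L_smooth_L_nonneg:
  assumes "L_smooth d L f gradf" "d \<ge> 1"
  shows "L \<ge> 0"
proof -
  define x y :: "nat \<Rightarrow> real" where "x = (\<lambda>i\<in>{..<d}. 0)" and "y = (\<lambda>i\<in>{..<d}. 1)"
  have "x \<in> Rd d" "y \<in> Rd d" unfolding x_def y_def by (rule restrict_in_Rd)+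
  then have "Rd_dist d (gradf x) (gradf y) \<le> L * Rd_dist d x y"
    using assms unfolding L_smooth_def by blast
  also have "Rd_dist d x y = Rd_norm d (\<lambda>_. - 1)"
    unfolding Rd_dist_def by (rule Rd_norm_cong) (simp add: x_def y_def)
  also have "\<dots> = sqrt (real d)" by (simp add: Rd_norm_def L2_set_def)
  finally have "0 \<le> L * sqrt (real d)"
    by (rule order_trans[rotated]) (simp add: Rd_dist_def Rd_norm_nonneg)
  with assms(2) show ?thesis by (simp add: zero_le_mult_iff)
qed

lemma has_gradient_along_line:
  assumes grad: "has_gradient d f v (\<lambda>i\<in>{..<d}. x i + s * h i)"
  shows "((\<lambda>s. f (\<lambda>i\<in>{..<d}. x i + s * h i)) has_real_derivative (\<Sum>i<d. v i * h i)) (at s)"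
proof -
  define y where "y s = (\<lambda>i\<in>{..<d}. x i + s * h i)" for s
  have dist: "Rd_dist d (y r) (y s) = \<bar>r - s\<bar> * Rd_norm d h" for r
  proof -
    have "Rd_dist d (y r) (y s) = Rd_norm d (\<lambda>i. (r - s) * h i)"
      unfolding Rd_dist_def by (rule Rd_norm_cong) (simp add: y_def algebra_simps)
    then show ?thesis by (simp add: Rd_norm_scale)
  qed
  have lin: "(\<Sum>i<d. v i * (y r i - y s i)) = (r - s) * (\<Sum>i<d. v i * h i)" for r
    unfolding sum_distrib_left by (rule sum.cong) (auto simp: y_def algebra_simps)
  show ?thesis
    unfolding has_field_derivative_iff y_def[symmetric]
  proof (rule LIM_I)
    fix e :: real assume e: "e > 0"
    define K where "K = Rd_norm d h + 1"
    have K: "K > 0" "Rd_norm d h < K" unfolding K_def using Rd_norm_nonneg[of d h] by auto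
    have "e / (2 * K) > 0" using e K by simp
    then obtain \<rho> where \<rho>: "\<rho> > 0" and approx: "\<And>z. z \<in> Rd d \<Longrightarrow> Rd_dist d z (y s) < \<rho> \<Longrightarrow>
        \<bar>f z - f (y s) - (\<Sum>i<d. v i * (z i - y s i))\<bar> \<le> e / (2 * K) * Rd_dist d z (y s)"
      using grad unfolding has_gradient_def y_def[symmetric] by blast
    show "\<exists>r>0. \<forall>z. z \<noteq> s \<and> norm (z - s) < r \<longrightarrow>
        norm ((f (y z) - f (y s)) / (z - s) - (\<Sum>i<d. v i * h i)) < e"
    proof (intro exI[of _ "\<rho> / K"] conjI allI impI)
      fix r assume r: "r \<noteq> s \<and> norm (r - s) < \<rho> / K"
      have "\<bar>r - s\<bar> * Rd_norm d h \<le> \<bar>r - s\<bar> * K" using K by (intro mult_left_mono) auto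
      also have "\<dots> < \<rho>" using r K by (simp add: pos_less_divide_eq)
      finally have "Rd_dist d (y r) (y s) < \<rho>" by (simp add: dist)
      then have "\<bar>f (y r) - f (y s) - (r - s) * (\<Sum>i<d. v i * h i)\<bar> \<le> e / (2 * K) * (\<bar>r - s\<bar> * Rd_norm d h)"
        using approx[of "y r"] by (simp add: dist lin) (simp add: y_def restrict_in_Rd)
      also have "\<dots> \<le> e / (2 * K) * (\<bar>r - s\<bar> * K)"
        using K e by (intro mult_left_mono) auto
      also have "\<dots> = e / 2 * \<bar>r - s\<bar>" using K by simp
      also have "\<dots> < e * \<bar>r - s\<bar>" using r e by simp
      finally have *: "\<bar>f (y r) - f (y s) - (r - s) * (\<Sum>i<d. v i * h i)\<bar> < e * \<bar>r - s\<bar>" .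
      have "(f (y r) - f (y s)) / (r - s) - (\<Sum>i<d. v i * h i)
          = (f (y r) - f (y s) - (r - s) * (\<Sum>i<d. v i * h i)) / (r - s)"
        using r by (simp add: diff_divide_distrib)
      then show "norm ((f (y r) - f (y s)) / (r - s) - (\<Sum>i<d. v i * h i)) < e"
        using * r by (simp add: abs_div pos_divide_less_eq)
    qed (use \<rho> K in simp)
  qed
qed

text \<open>
  Along the segment from \<open>x\<close> to \<open>x + h\<close>, subtracting the quadratic upper bound from \<open>f\<close> leaves a
  function whose derivative is nonpositive by the Lipschitz condition.
\<close>

lemma descent_inequality:
  assumes smooth: "L_smooth d L f gradf" and x: "x \<in> Rd d"
  shows "f (\<lambda>i\<in>{..<d}. x i + h i) \<le> f x + (\<Sum>i<d. gradf x i * h i) + L / 2 * (Rd_norm d h)\<^sup>2"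
proof -
  define y where "y s = (\<lambda>i\<in>{..<d}. x i + s * h i)" for s
  define \<phi> where "\<phi> s = f (y s) - s * (\<Sum>i<d. gradf x i * h i) - L / 2 * s\<^sup>2 * (Rd_norm d h)\<^sup>2" for s
  have y_Rd: "y s \<in> Rd d" for s unfolding y_def by (rule restrict_in_Rd)
  have y0: "y 0 = x" using x by (auto simp: y_def Rd_def extensional_def PiE_def fun_eq_iff)
  have "\<phi> 1 \<le> \<phi> 0"
  proof (rule DERIV_nonpos_imp_nonincreasing[of 0 1 \<phi>])
    fix s :: real assume s: "0 \<le> s" "s \<le> 1"
    have der: "((\<lambda>s. f (y s)) has_real_derivative (\<Sum>i<d. gradf (y s) i * h i)) (at s)"
      unfolding y_def
      by (rule has_gradient_along_line) (use smooth y_Rd[of s] in \<open>auto simp: L_smooth_def y_def\<close>)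
    have "(\<phi> has_real_derivative (\<Sum>i<d. gradf (y s) i * h i) - (\<Sum>i<d. gradf x i * h i)
        - L * s * (Rd_norm d h)\<^sup>2) (at s)"
      unfolding \<phi>_def by (rule derivative_eq_intros der refl | simp)+
    moreover have "(\<Sum>i<d. gradf (y s) i * h i) - (\<Sum>i<d. gradf x i * h i) - L * s * (Rd_norm d h)\<^sup>2 \<le> 0"
    proof -
      have "(\<Sum>i<d. gradf (y s) i * h i) - (\<Sum>i<d. gradf x i * h i)
          = (\<Sum>i<d. (gradf (y s) i - gradf x i) * h i)"
        by (simp add: sum_subtractf left_diff_distrib)
      also have "\<dots> \<le> Rd_dist d (gradf (y s)) (gradf x) * Rd_norm d h"
        unfolding Rd_dist_def by (rule order_trans[OF abs_ge_self Rd_inner_le])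
      also have "\<dots> \<le> (L * Rd_dist d (y s) x) * Rd_norm d h"
        using smooth y_Rd x Rd_norm_nonneg unfolding L_smooth_def by (intro mult_right_mono) auto
      also have "Rd_dist d (y s) x = Rd_norm d (\<lambda>i. s * h i)"
        unfolding Rd_dist_def by (rule Rd_norm_cong) (simp add: y_def)
      also have "\<dots> = s * Rd_norm d h" using s by (simp add: Rd_norm_scale)
      finally show ?thesis by (simp add: power2_eq_square ac_simps)
    qed
    ultimately show "\<exists>l. (\<phi> has_real_derivative l) (at s) \<and> l \<le> 0" by blast
  qed simp
  then show ?thesis unfolding \<phi>_def by (simp add: y0) (simp add: y_def)
qed

text \<open>
  A gradient step \<open>x - c * gradf x\<close> cannot go below the lower bound; \<open>c = 1 / L\<close> is the best step.
  For \<open>L = 0\<close> the step can be arbitrarily long, which forces the gradient to vanish.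
\<close>

lemma gradient_sq_le_gap:
  assumes smooth: "L_smooth d L f gradf" and x: "x \<in> Rd d" and L: "L \<ge> 0"
    and lower: "\<And>y. y \<in> Rd d \<Longrightarrow> fstar \<le> f y"
  shows "(Rd_norm d (gradf x))\<^sup>2 \<le> 2 * L * (f x - fstar)"
proof -
  define P where "P = (Rd_norm d (gradf x))\<^sup>2"
  have step: "c * P \<le> (f x - fstar) + L / 2 * c\<^sup>2 * P" for c
  proof -
    have "fstar \<le> f (\<lambda>i\<in>{..<d}. x i + - c * gradf x i)" by (rule lower) (rule restrict_in_Rd)
    also have "\<dots> \<le> f x + (\<Sum>i<d. gradf x i * (- c * gradf x i)) + L / 2 * (Rd_norm d (\<lambda>i. - c * gradf x i))\<^sup>2"
      by (rule descent_inequality[OF smooth x])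
    also have "(\<Sum>i<d. gradf x i * (- c * gradf x i)) = - c * P"
      unfolding P_def Rd_norm_sq sum_distrib_left
      by (rule sum.cong) (auto simp: power2_eq_square)
    also have "(Rd_norm d (\<lambda>i. - c * gradf x i))\<^sup>2 = c\<^sup>2 * P"
      unfolding Rd_norm_scale power_mult_distrib P_def by simp
    finally show ?thesis by (simp add: algebra_simps)
  qed
  have gap: "0 \<le> f x - fstar" using lower[OF x] by simp
  have "P \<le> 2 * L * (f x - fstar)"
  proof (cases "L = 0")
    case True
    then have *: "c * P \<le> f x - fstar" for c using step[of c] by simp
    have "P \<le> 0"
    proof (rule ccontr)
      assume "\<not> P \<le> 0"
      then show False using *[of "(f x - fstar + 1) / P"] by simp
    qed
    then show ?thesis using True by simp
  next
    case False
    then have "L > 0" using L by simp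
    have "L / 2 * (1 / L)\<^sup>2 * P = P / (2 * L)" using False by (simp add: power2_eq_square)
    then have "1 / L * P \<le> (f x - fstar) + P / (2 * L)" using step[of "1 / L"] by simp
    moreover have "1 / L * P = P / (2 * L) + P / (2 * L)" using False by (simp add: field_simps)
    ultimately have "P / (2 * L) \<le> f x - fstar" by linarith
    then show ?thesis using \<open>L > 0\<close> by (simp add: pos_divide_le_eq mult.commute)
  qed
  then show ?thesis by (simp add: P_def)
qed

section \<open>Analysis of a single run\<close>

text \<open>
  One realization of the algorithm, reduced to scalars.  At step \<open>t\<close>, \<open>p t\<close>, \<open>q t\<close> and \<open>n t\<close> are
  the norms of the gradient, of the stochastic gradient and of the noise, \<open>e t\<close> is the inner product
  of the gradient with the noise, and \<open>F t\<close> is the function value above the lower bound.  Steps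
  count from \<open>0\<close>, so the denominator of the step size at step \<open>t\<close> is \<open>b (Suc t)\<close>, while \<open>b t\<close> is
  known before the noise of step \<open>t\<close> is drawn.
\<close>

locale adagrad_path =
  fixes \<eta> L b0 :: real and p q n e F b :: "nat \<Rightarrow> real"
  assumes eta_pos: "\<eta> > 0" and b0_pos: "b0 > 0" and L_nonneg: "L \<ge> 0"
    and p_nonneg: "\<And>t. p t \<ge> 0" and q_nonneg: "\<And>t. q t \<ge> 0" and n_nonneg: "\<And>t. n t \<ge> 0"
    and answer_sq: "\<And>t. (q t)\<^sup>2 = (p t)\<^sup>2 + 2 * e t + (n t)\<^sup>2"
    and noise_CS: "\<And>t. \<bar>e t\<bar> \<le> p t * n t"
    and answer_CS: "\<And>t. \<bar>(p t)\<^sup>2 + e t\<bar> \<le> p t * q t"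
    and b_0: "b 0 = b0" and b_Suc: "\<And>t. b (Suc t) = sqrt ((b t)\<^sup>2 + (q t)\<^sup>2)"
    and gap_nonneg: "\<And>t. F t \<ge> 0"
    and descent: "\<And>t. F (Suc t) \<le> F t - \<eta> * (((p t)\<^sup>2 + e t) / b (Suc t))
        + L * \<eta>\<^sup>2 / 2 * ((q t)\<^sup>2 / (b (Suc t))\<^sup>2)"
begin

lemma b_pos: "b t > 0"
proof (induction t)
  case (Suc t)
  then have "0 < (b t)\<^sup>2 + (q t)\<^sup>2" by (simp add: add_pos_nonneg)
  then show ?case by (simp add: b_Suc)
qed (simp add: b_0 b0_pos)

lemma b_Suc_sq: "(b (Suc t))\<^sup>2 = (b t)\<^sup>2 + (q t)\<^sup>2"
  by (simp add: b_Suc)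

lemma b_le_Suc: "b t \<le> b (Suc t)"
  by (rule power2_le_imp_le) (use b_pos[of "Suc t"] in \<open>auto simp: b_Suc_sq\<close>)

lemma q_le_b: "q t \<le> b (Suc t)"
  by (rule power2_le_imp_le) (use b_pos[of "Suc t"] in \<open>auto simp: b_Suc_sq\<close>)

lemma b_mono: "s \<le> t \<Longrightarrow> b s \<le> b t"
  using lift_Suc_mono_le[of b s t] b_le_Suc by blast

lemma b0_le: "b0 \<le> b t"
  using b_mono[of 0 t] by (simp add: b_0)

lemma b_sq_expand: "(b k)\<^sup>2 = b0\<^sup>2 + (\<Sum>t<k. (p t)\<^sup>2) + 2 * (\<Sum>t<k. e t) + (\<Sum>t<k. (n t)\<^sup>2)"
  by (induction k) (auto simp: b_0 b_Suc_sq answer_sq)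

lemma noise_reverse_triangle: "(p t - n t)\<^sup>2 \<le> (q t)\<^sup>2"
proof -
  have "- (p t * n t) \<le> e t" using noise_CS[of t] by linarith
  then show ?thesis using answer_sq[of t] unfolding power2_diff by linarith
qed

text \<open>
  Each summand is \<open>1 - u \<le> ln (1 / u)\<close> with \<open>u\<close> the ratio of consecutive \<open>b\<^sup>2\<close>, and the logarithms
  telescope.  This is what makes the second-order terms of the descent inequality harmless.
\<close>

lemma log_sum_le: "(\<Sum>t<k. (q t)\<^sup>2 / (b (Suc t))\<^sup>2) \<le> 2 * ln (b k / b0)"
proof (induction k)
  case (Suc k)
  have pos: "b k > 0" "b (Suc k) > 0" by (rule b_pos)+
  have "ln ((b k)\<^sup>2 / (b (Suc k))\<^sup>2) \<le> (b k)\<^sup>2 / (b (Suc k))\<^sup>2 - 1"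
    using pos by (intro ln_le_minus_one) auto
  moreover have "ln ((b k)\<^sup>2 / (b (Suc k))\<^sup>2) = 2 * ln (b k) - 2 * ln (b (Suc k))"
    using pos by (simp add: ln_div ln_realpow)
  moreover have "(q k)\<^sup>2 / (b (Suc k))\<^sup>2 = 1 - (b k)\<^sup>2 / (b (Suc k))\<^sup>2"
  proof -
    have "(q k)\<^sup>2 = (b (Suc k))\<^sup>2 - (b k)\<^sup>2" by (simp add: b_Suc_sq)
    then show ?thesis using pos by (simp add: diff_divide_distrib)
  qed
  ultimately have "(q k)\<^sup>2 / (b (Suc k))\<^sup>2 \<le> 2 * ln (b (Suc k)) - 2 * ln (b k)" by linarith
  with Suc show ?case using pos b0_pos by (simp add: ln_div)
qed (use b0_pos in \<open>simp add: b_0\<close>)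

lemma descent_sum:
  "(\<Sum>t<k. ((p t)\<^sup>2 + e t) / b (Suc t)) \<le> F 0 / \<eta> + L * \<eta> * ln (b k / b0)"
proof -
  have "F k + \<eta> * (\<Sum>t<k. ((p t)\<^sup>2 + e t) / b (Suc t))
      \<le> F 0 + L * \<eta>\<^sup>2 / 2 * (\<Sum>t<k. (q t)\<^sup>2 / (b (Suc t))\<^sup>2)"
  proof (induction k)
    case (Suc k)
    show ?case using Suc descent[of k] by (simp add: algebra_simps)
  qed simp
  also have "\<dots> \<le> F 0 + L * \<eta>\<^sup>2 / 2 * (2 * ln (b k / b0))"
    using log_sum_le[of k] L_nonneg by (intro add_left_mono mult_left_mono) auto
  finally have "\<eta> * (\<Sum>t<k. ((p t)\<^sup>2 + e t) / b (Suc t)) \<le> F 0 + L * \<eta>\<^sup>2 * ln (b k / b0)"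
    using gap_nonneg[of k] by simp
  then have "(\<Sum>t<k. ((p t)\<^sup>2 + e t) / b (Suc t)) \<le> (F 0 + L * \<eta>\<^sup>2 * ln (b k / b0)) / \<eta>"
    using eta_pos by (simp add: pos_le_divide_eq mult.commute)
  also have "\<dots> = F 0 / \<eta> + L * \<eta> * ln (b k / b0)"
    using eta_pos by (simp add: add_divide_distrib power2_eq_square)
  finally show ?thesis .
qed

lemma early_steps:
  "\<exists>k\<le>T. (\<forall>t<k. (b (Suc t))\<^sup>2 \<le> J) \<and> (\<forall>t\<ge>k. t < T \<longrightarrow> J < (b (Suc t))\<^sup>2)"
proof -
  define k where "k = (LEAST t. t = T \<or> J < (b (Suc t))\<^sup>2)"
  have k: "k = T \<or> J < (b (Suc k))\<^sup>2"
    unfolding k_def by (rule LeastI[of _ T]) simp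
  have "k \<le> T" unfolding k_def by (rule Least_le) simp
  moreover have "(b (Suc t))\<^sup>2 \<le> J" if "t < k" for t
    using not_less_Least[OF that[unfolded k_def]] by simp
  moreover have "J < (b (Suc t))\<^sup>2" if "k \<le> t" "t < T" for t
  proof -
    have "(b (Suc k))\<^sup>2 \<le> (b (Suc t))\<^sup>2"
      using that b_mono[of "Suc k" "Suc t"] b_pos[of "Suc k"] by (intro power_mono) auto
    with k that show ?thesis by auto
  qed
  ultimately show ?thesis by blast
qed

text \<open>
  Where \<open>b\<^sup>2\<close> dominates \<open>V\<close>, the accumulated noise plus \<open>b0\<^sup>2\<close>, the sum of \<open>n\<^sup>2 / b\<close> is at most
  a constant times that of \<open>n\<^sup>2 / sqrt V\<close>, which telescopes like the integral of \<open>1 / sqrt V\<close>.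
\<close>

lemma late_noise_sum:
  assumes "k \<le> T" and "\<And>t. k \<le> t \<Longrightarrow> t < T \<Longrightarrow> b0\<^sup>2 + (\<Sum>i<Suc t. (n i)\<^sup>2) \<le> 2 * (b (Suc t))\<^sup>2"
  shows "(\<Sum>t=k..<T. (n t)\<^sup>2 / b (Suc t)) \<le> 3 * sqrt (b0\<^sup>2 + (\<Sum>t<T. (n t)\<^sup>2))"
proof -
  define Y where "Y t = sqrt (b0\<^sup>2 + (\<Sum>i<t. (n i)\<^sup>2))" for t
  have Ysq: "(Y t)\<^sup>2 = b0\<^sup>2 + (\<Sum>i<t. (n i)\<^sup>2)" for t
    unfolding Y_def by (simp add: sum_nonneg)
  have Ypos: "Y t > 0" for t
    unfolding Y_def using b0_pos by (simp add: add_pos_nonneg sum_nonneg)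
  have step: "(n t)\<^sup>2 / b (Suc t) \<le> 3 * (Y (Suc t) - Y t)" if "k \<le> t" "t < T" for t
  proof -
    have mono: "Y t \<le> Y (Suc t)" unfolding Y_def by simp
    have "(2 * Y (Suc t))\<^sup>2 \<le> (3 * b (Suc t))\<^sup>2"
    proof -
      have "4 * (Y (Suc t))\<^sup>2 \<le> 8 * (b (Suc t))\<^sup>2" using assms(2)[OF that] unfolding Ysq by simp
      moreover have "(2 * Y (Suc t))\<^sup>2 = 4 * (Y (Suc t))\<^sup>2" "(3 * b (Suc t))\<^sup>2 = 9 * (b (Suc t))\<^sup>2"
        by (simp_all add: power_mult_distrib)
      ultimately show ?thesis using zero_le_power2[of "b (Suc t)"] by linarith
    qed
    then have le: "2 * Y (Suc t) \<le> 3 * b (Suc t)"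
      by (rule power2_le_imp_le) (use b_pos[of "Suc t"] in simp)
    have "(n t)\<^sup>2 = (Y (Suc t))\<^sup>2 - (Y t)\<^sup>2" unfolding Ysq by simp
    also have "\<dots> = (Y (Suc t) - Y t) * (Y (Suc t) + Y t)"
      by (simp add: power2_eq_square algebra_simps)
    also have "\<dots> \<le> (Y (Suc t) - Y t) * (3 * b (Suc t))"
      using mono le by (intro mult_left_mono) auto
    finally have "(n t)\<^sup>2 \<le> 3 * (Y (Suc t) - Y t) * b (Suc t)" by (simp only: ac_simps)
    then show ?thesis using b_pos[of "Suc t"] by (simp only: pos_divide_le_eq)
  qed
  have "(\<Sum>t=k..<T. (n t)\<^sup>2 / b (Suc t)) \<le> (\<Sum>t=k..<T. 3 * (Y (Suc t) - Y t))"
    using step by (intro sum_mono) auto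
  also have "\<dots> = 3 * (Y T - Y k)"
    using sum_Suc_diff'[OF assms(1), of Y] by (simp only: sum_distrib_left[symmetric])
  also have "\<dots> \<le> 3 * Y T" using Ypos[of k] by simp
  finally show ?thesis unfolding Y_def .
qed

text \<open>
  The increment of \<open>b\<close> at a step is at most \<open>q\<^sup>2 / b\<close>, and \<open>q\<^sup>2 \<le> n\<^sup>2 + 2 s\<close> where \<open>s\<close> is the inner
  product of the gradient with the stochastic gradient.  The sum of \<open>s / b\<close> is what the decrease of
  the objective pays for, so \<open>b T\<close> is bounded as soon as the sum of \<open>n\<^sup>2 / b\<close> is.

  The hypothesis \<open>lower\<close> limits to \<open>J\<close> what cancellation between noise and gradients can hide from
  \<open>b\<^sup>2\<close>, so this sum is under control once \<open>b\<^sup>2\<close> exceeds \<open>J\<close>.  The steps up to that moment keep \<open>b\<close>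
  below \<open>b0 + sqrt J\<close>, but they may increase the objective.  Their damage is bounded in two ways.
  At every step \<open>- s / b \<le> p\<close>, which by Cauchy-Schwarz adds up to the order of \<open>sqrt (T J)\<close>, and
  \<open>- s / b \<le> n\<^sup>2 / (4 b0)\<close>, which adds up to the order of \<open>J / b0\<close>.
\<close>

lemma step_size_implicit_bound:
  assumes J: "J \<ge> 0"
    and lower: "\<And>k. k \<le> T \<Longrightarrow>
      b0\<^sup>2 + (\<Sum>t<k. (p t)\<^sup>2) / 2 + (\<Sum>t<k. (n t)\<^sup>2) \<le> (b k)\<^sup>2 + J"
  shows "b T \<le> b0 + sqrt J + 3 * sqrt (b0\<^sup>2 + (\<Sum>t<T. (n t)\<^sup>2))
      + 2 * min (2 * sqrt (real T * J)) (J / (2 * b0)) + 2 * F 0 / \<eta> + 2 * L * \<eta> * ln (b T / b0)"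
proof -
  define s where "s t = (p t)\<^sup>2 + e t" for t
  \<comment> \<open>The first \<open>k\<close> steps are those that keep \<open>b\<^sup>2 \<le> J\<close>.\<close>
  obtain k where k: "k \<le> T" and early: "\<And>t. t < k \<Longrightarrow> (b (Suc t))\<^sup>2 \<le> J"
    and late: "\<And>t. k \<le> t \<Longrightarrow> t < T \<Longrightarrow> J < (b (Suc t))\<^sup>2"
    using early_steps[of T J] by blast
  have bk: "b k \<le> b0 + sqrt J"
  proof (cases k)
    case (Suc k')
    then have "b k \<le> sqrt J" using early[of k'] by (intro real_le_rsqrt) simp
    then show ?thesis using b0_pos by simp
  qed (use J in \<open>simp add: b_0\<close>)
  have UV: "(\<Sum>t<k. (p t)\<^sup>2) / 2 + (\<Sum>t<k. (n t)\<^sup>2) \<le> 2 * J"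
  proof (cases k)
    case (Suc k')
    then have "(b k)\<^sup>2 \<le> J" using early[of k'] by simp
    then show ?thesis using lower[OF k] zero_le_power2[of b0] by linarith
  qed (use J in simp)
  have U: "(\<Sum>t<k. (p t)\<^sup>2) \<le> 4 * J" and V: "(\<Sum>t<k. (n t)\<^sup>2) \<le> 2 * J"
    using UV sum_nonneg[of "{..<k}" "\<lambda>t. (p t)\<^sup>2"] sum_nonneg[of "{..<k}" "\<lambda>t. (n t)\<^sup>2"] by auto
  \<comment> \<open>The damage done to the objective by the early steps.\<close>
  define P where "P = (\<Sum>t<k. - (s t / b (Suc t)))"
  have P1: "P \<le> 2 * sqrt (real T * J)"
  proof -
    have "- (s t / b (Suc t)) \<le> p t" for t
    proof -
      have "p t * q t \<le> p t * b (Suc t)" using q_le_b p_nonneg by (intro mult_left_mono)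
      then have "- s t \<le> p t * b (Suc t)" using answer_CS[of t] unfolding s_def by linarith
      then show ?thesis using b_pos[of "Suc t"] by (simp only: minus_divide_left pos_divide_le_eq)
    qed
    then have "P \<le> (\<Sum>t<k. p t)" unfolding P_def by (intro sum_mono)
    also have "\<dots> \<le> sqrt (real k) * sqrt (\<Sum>t<k. (p t)\<^sup>2)"
    proof -
      have "(\<Sum>t<k. \<bar>1\<bar> * \<bar>p t\<bar>) \<le> L2_set (\<lambda>_. 1) {..<k} * L2_set p {..<k}"
        by (rule L2_set_mult_ineq)
      then show ?thesis using p_nonneg by (simp add: L2_set_def)
    qed
    also have "\<dots> \<le> sqrt (real T) * sqrt (4 * J)"
      using k U J by (intro mult_mono real_sqrt_le_mono) (auto simp: sum_nonneg)
    also have "\<dots> = 2 * sqrt (real T * J)" by (simp add: real_sqrt_mult)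
    finally show ?thesis .
  qed
  have P2: "P \<le> J / (2 * b0)"
  proof -
    have "- (s t / b (Suc t)) \<le> (n t)\<^sup>2 / (4 * b0)" for t
    proof -
      have "0 \<le> (2 * p t - n t)\<^sup>2" by simp
      then have "4 * (p t * n t) \<le> 4 * (p t)\<^sup>2 + (n t)\<^sup>2"
        by (simp add: power2_eq_square algebra_simps)
      then have "- s t \<le> (n t)\<^sup>2 / 4" using noise_CS[of t] unfolding s_def by linarith
      then have "- (s t / b (Suc t)) \<le> (n t)\<^sup>2 / 4 / b (Suc t)"
        using b_pos[of "Suc t"] divide_right_mono[of "- s t" "(n t)\<^sup>2 / 4" "b (Suc t)"] by simp
      also have "\<dots> \<le> (n t)\<^sup>2 / 4 / b0"
        using b0_le b0_pos by (intro divide_left_mono) (auto intro!: mult_pos_pos b_pos)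
      finally show ?thesis by simp
    qed
    then have "P \<le> (\<Sum>t<k. (n t)\<^sup>2 / (4 * b0))" unfolding P_def by (intro sum_mono)
    also have "\<dots> = (\<Sum>t<k. (n t)\<^sup>2) / (4 * b0)" by (simp add: sum_divide_distrib)
    also have "\<dots> \<le> 2 * J / (4 * b0)" using V b0_pos by (intro divide_right_mono) auto
    finally show ?thesis by simp
  qed
  have split: "(\<Sum>t<T. s t / b (Suc t)) = - P + (\<Sum>t=k..<T. s t / b (Suc t))"
    unfolding P_def using k
    by (simp add: sum_negf lessThan_atLeast0 sum.atLeastLessThan_concat)
  have half: "(q t)\<^sup>2 / b (Suc t) \<le> (n t)\<^sup>2 / b (Suc t) + 2 * (s t / b (Suc t))" for t
  proof -
    have "(q t)\<^sup>2 \<le> (n t)\<^sup>2 + 2 * s t" using answer_sq[of t] unfolding s_def by simp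
    then have "(q t)\<^sup>2 / b (Suc t) \<le> ((n t)\<^sup>2 + 2 * s t) / b (Suc t)"
      using b_pos[of "Suc t"] by (intro divide_right_mono) auto
    then show ?thesis by (simp add: add_divide_distrib)
  qed
  have incr: "b (Suc t) - b t \<le> (q t)\<^sup>2 / b (Suc t)" for t
  proof -
    have "(b (Suc t) - b t) * b (Suc t) \<le> (b (Suc t) - b t) * (b (Suc t) + b t)"
      using b_le_Suc[of t] b_pos[of t] by (intro mult_left_mono) auto
    also have "\<dots> = (q t)\<^sup>2" using b_Suc_sq[of t] by (simp add: algebra_simps power2_eq_square)
    finally show ?thesis using b_pos[of "Suc t"] by (simp add: pos_le_divide_eq)
  qed
  have late_noise: "(\<Sum>t=k..<T. (n t)\<^sup>2 / b (Suc t)) \<le> 3 * sqrt (b0\<^sup>2 + (\<Sum>t<T. (n t)\<^sup>2))"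
  proof (rule late_noise_sum[OF k])
    fix t assume t: "k \<le> t" "t < T"
    show "b0\<^sup>2 + (\<Sum>i<Suc t. (n i)\<^sup>2) \<le> 2 * (b (Suc t))\<^sup>2"
      using late[OF t] lower[of "Suc t"] t sum_nonneg[of "{..<Suc t}" "\<lambda>t. (p t)\<^sup>2"]
      by (simp del: sum.lessThan_Suc)
  qed
  have "b T - b k = (\<Sum>t=k..<T. b (Suc t) - b t)" using k by (simp add: sum_Suc_diff')
  also have "\<dots> \<le> (\<Sum>t=k..<T. (n t)\<^sup>2 / b (Suc t) + 2 * (s t / b (Suc t)))"
    using incr half by (intro sum_mono) (blast intro: order_trans)
  also have "\<dots> = (\<Sum>t=k..<T. (n t)\<^sup>2 / b (Suc t)) + 2 * (\<Sum>t=k..<T. s t / b (Suc t))"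
    by (simp add: sum.distrib sum_distrib_left)
  also have "\<dots> \<le> 3 * sqrt (b0\<^sup>2 + (\<Sum>t<T. (n t)\<^sup>2))
      + 2 * (F 0 / \<eta> + L * \<eta> * ln (b T / b0) + P)"
  proof (intro add_mono mult_left_mono late_noise)
    show "(\<Sum>t=k..<T. s t / b (Suc t)) \<le> F 0 / \<eta> + L * \<eta> * ln (b T / b0) + P"
      using descent_sum[of T, folded s_def] split by linarith
  qed simp
  finally have "b T \<le> b k + (3 * sqrt (b0\<^sup>2 + (\<Sum>t<T. (n t)\<^sup>2))
      + 2 * (F 0 / \<eta> + L * \<eta> * ln (b T / b0) + P))" by simp
  moreover define Q where "Q = min (2 * sqrt (real T * J)) (J / (2 * b0))"
  moreover have "P \<le> Q" using P1 P2 by (simp add: Q_def)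
  moreover have "2 * (F 0 / \<eta> + L * \<eta> * ln (b T / b0) + P)
      = 2 * F 0 / \<eta> + 2 * L * \<eta> * ln (b T / b0) + 2 * P" by (simp add: algebra_simps)
  ultimately show ?thesis unfolding Q_def[symmetric] using bk by linarith
qed

text \<open>
  The true denominator \<open>b (Suc t)\<close> depends on the noise of step \<open>t\<close>, which spoils the martingale
  property of the noise term.  The proof compares it with \<open>a t = sqrt (b\<^sup>2 + p\<^sup>2 + m\<^sup>2)\<close>, which is
  known beforehand.  With \<open>m\<close> a bound on the noise, \<open>1 / a\<close> and \<open>1 / b\<close> differ by at most
  \<open>2 m / (a b)\<close>, and the resulting error splits into a quarter of \<open>p\<^sup>2 / a\<close>, which is absorbed, and
  a multiple of \<open>m q\<^sup>2 / b\<^sup>2\<close>, whose sum is logarithmic.  The summand \<open>m\<^sup>2\<close> inside \<open>a\<close> is what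
  keeps the factor \<open>m\<close> in this error to the first power.
\<close>

lemma gradient_sum_bound:
  assumes m: "m > 0" and noise_le: "\<And>t. t < T \<Longrightarrow> n t \<le> m"
    and mart: "- (\<Sum>t<T. e t / sqrt ((b t)\<^sup>2 + (p t)\<^sup>2 + m\<^sup>2))
      \<le> (\<Sum>t<T. (p t)\<^sup>2 / sqrt ((b t)\<^sup>2 + (p t)\<^sup>2 + m\<^sup>2)) / 4 + 4 * m"
  shows "(\<Sum>t<T. (p t)\<^sup>2)
    \<le> 2 * (b T + m) * (2 * F 0 / \<eta> + 8 * m + (2 * L * \<eta> + 16 * m) * ln (b T / b0))"
proof -
  define a where "a t = sqrt ((b t)\<^sup>2 + (p t)\<^sup>2 + m\<^sup>2)" for t
  define s where "s t = (p t)\<^sup>2 + e t" for t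
  define A where "A = (\<Sum>t<T. (p t)\<^sup>2 / a t)"
  have a_sq: "(a t)\<^sup>2 = (b t)\<^sup>2 + (p t)\<^sup>2 + m\<^sup>2" for t unfolding a_def by simp
  have a_m: "m \<le> a t" for t unfolding a_def by (rule real_le_rsqrt) simp
  have a_pos: "a t > 0" for t using a_m[of t] m by linarith
  have p_a: "p t \<le> a t" for t unfolding a_def by (rule real_le_rsqrt) simp
  have step: "(p t)\<^sup>2 / a t + e t / a t \<le>
      s t / b (Suc t) + (p t)\<^sup>2 / a t / 4 + 4 * m * ((q t)\<^sup>2 / (b (Suc t))\<^sup>2)"
    if t: "t < T" for t
  proof -
    let ?a = "a t" and ?b = "b (Suc t)"
    have pos: "?a > 0" "?b > 0" using a_pos b_pos by auto
    have nm: "n t \<le> m" using noise_le t by blast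
    have diff_sq: "\<bar>?b\<^sup>2 - ?a\<^sup>2\<bar> \<le> 2 * m * (?a + ?b)"
    proof -
      have qp: "\<bar>q t - p t\<bar> \<le> n t"
      proof -
        have "(q t)\<^sup>2 \<le> (p t + n t)\<^sup>2"
          using noise_CS[of t] answer_sq[of t] unfolding power2_sum by linarith
        then have "q t \<le> p t + n t"
          by (rule power2_le_imp_le) (use p_nonneg[of t] n_nonneg[of t] in auto)
        moreover have "p t - n t \<le> q t"
          by (rule power2_le_imp_le[OF noise_reverse_triangle q_nonneg])
        ultimately show ?thesis by linarith
      qed
      have "?b\<^sup>2 - ?a\<^sup>2 = (q t - p t) * (q t + p t) - m\<^sup>2"
        unfolding a_sq b_Suc_sq by (simp add: power2_eq_square algebra_simps)
      then have "\<bar>?b\<^sup>2 - ?a\<^sup>2\<bar> \<le> \<bar>q t - p t\<bar> * (q t + p t) + m * m"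
        using p_nonneg[of t] q_nonneg[of t] abs_triangle_ineq4[of "(q t - p t) * (q t + p t)" "m\<^sup>2"]
        by (simp add: abs_mult power2_eq_square)
      also have "\<dots> \<le> m * (?b + ?a) + m * (?a + ?b)"
      proof (rule add_mono)
        show "\<bar>q t - p t\<bar> * (q t + p t) \<le> m * (?b + ?a)"
        proof (rule mult_mono)
          show "\<bar>q t - p t\<bar> \<le> m" using qp nm by linarith
          show "q t + p t \<le> ?b + ?a" using q_le_b[of t] p_a[of t] by linarith
        qed (use m p_nonneg[of t] q_nonneg[of t] in auto)
        show "m * m \<le> m * (?a + ?b)"
          using a_m[of t] pos m by (intro mult_left_mono) auto
      qed
      finally show ?thesis by (simp add: algebra_simps)
    qed
    have diff: "\<bar>1 / ?a - 1 / ?b\<bar> \<le> 2 * m / (?a * ?b)"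
    proof -
      have "\<bar>?b - ?a\<bar> * (?a + ?b) = \<bar>?b\<^sup>2 - ?a\<^sup>2\<bar>"
      proof -
        have "?b\<^sup>2 - ?a\<^sup>2 = (?b - ?a) * (?a + ?b)" by (simp add: power2_eq_square algebra_simps)
        then show ?thesis using pos by (simp add: abs_mult)
      qed
      then have "\<bar>?b - ?a\<bar> * (?a + ?b) \<le> 2 * m * (?a + ?b)" using diff_sq by simp
      then have "\<bar>?b - ?a\<bar> \<le> 2 * m" using pos by (simp only: mult_le_cancel_right_pos add_pos_pos)
      moreover have "1 / ?a - 1 / ?b = (?b - ?a) / (?a * ?b)" using pos by (simp add: divide_simps)
      ultimately show ?thesis using pos by (simp add: abs_div divide_right_mono)
    qed
    have "s t * (1 / ?a - 1 / ?b) \<le> \<bar>s t\<bar> * \<bar>1 / ?a - 1 / ?b\<bar>"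
      by (metis abs_ge_self abs_mult)
    also have "\<dots> \<le> (p t * q t) * (2 * m / (?a * ?b))"
      using diff answer_CS[of t] p_nonneg q_nonneg unfolding s_def by (intro mult_mono) auto
    also have "\<dots> = (p t * (2 * m * q t / ?b)) / ?a" by (simp add: ac_simps)
    also have "\<dots> \<le> ((p t)\<^sup>2 / 4 + (2 * m * q t / ?b)\<^sup>2) / ?a"
    proof (intro divide_right_mono)
      have "0 \<le> (p t / 2 - 2 * m * q t / ?b)\<^sup>2" by simp
      then show "p t * (2 * m * q t / ?b) \<le> (p t)\<^sup>2 / 4 + (2 * m * q t / ?b)\<^sup>2"
        unfolding power2_diff by (simp add: power_divide)
    qed (use pos in auto)
    also have "\<dots> = (p t)\<^sup>2 / ?a / 4 + (4 * m * ((q t)\<^sup>2 / ?b\<^sup>2)) * (m / ?a)"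
    proof -
      have "(2 * m * q t / ?b)\<^sup>2 = (4 * m * ((q t)\<^sup>2 / ?b\<^sup>2)) * m"
        by (simp add: power_mult_distrib power_divide) (simp add: power2_eq_square)
      then show ?thesis by (simp add: add_divide_distrib)
    qed
    also have "\<dots> \<le> (p t)\<^sup>2 / ?a / 4 + (4 * m * ((q t)\<^sup>2 / ?b\<^sup>2)) * 1"
      using a_m[of t] pos m by (intro add_left_mono mult_left_mono) auto
    finally have "s t * (1 / ?a - 1 / ?b) \<le> (p t)\<^sup>2 / ?a / 4 + 4 * m * ((q t)\<^sup>2 / ?b\<^sup>2)" by simp
    moreover have "s t * (1 / ?a - 1 / ?b) = s t / ?a - s t / ?b" by (simp add: right_diff_distrib)
    moreover have "s t / ?a = (p t)\<^sup>2 / ?a + e t / ?a" by (simp add: s_def add_divide_distrib)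
    ultimately show ?thesis by linarith
  qed
  have "A + (\<Sum>t<T. e t / a t) \<le> (\<Sum>t<T. s t / b (Suc t)) + A / 4
      + 4 * m * (\<Sum>t<T. (q t)\<^sup>2 / (b (Suc t))\<^sup>2)"
  proof -
    have "(\<Sum>t<T. (p t)\<^sup>2 / a t + e t / a t)
        \<le> (\<Sum>t<T. s t / b (Suc t) + (p t)\<^sup>2 / a t / 4 + 4 * m * ((q t)\<^sup>2 / (b (Suc t))\<^sup>2))"
      using step by (intro sum_mono) auto
    then show ?thesis
      unfolding A_def sum.distrib sum_distrib_left[symmetric] sum_divide_distrib[symmetric] .
  qed
  also have "\<dots> \<le> (F 0 / \<eta> + L * \<eta> * ln (b T / b0)) + A / 4 + 4 * m * (2 * ln (b T / b0))"
    using descent_sum[of T] log_sum_le[of T] m unfolding s_def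
    by (intro add_mono mult_left_mono) auto
  finally have sum_le: "A + (\<Sum>t<T. e t / a t)
      \<le> F 0 / \<eta> + L * \<eta> * ln (b T / b0) + A / 4 + 4 * m * (2 * ln (b T / b0))" .
  define K where "K = L * \<eta> * ln (b T / b0)"
  define K' where "K' = m * ln (b T / b0)"
  have "A \<le> 2 * F 0 / \<eta> + 8 * m + (2 * K + 16 * K')"
  proof -
    have "- (\<Sum>t<T. e t / a t) \<le> A / 4 + 4 * m" using mart unfolding A_def a_def .
    moreover have "4 * m * (2 * ln (b T / b0)) = 8 * K'" by (simp add: K'_def)
    ultimately show ?thesis using sum_le unfolding K_def[symmetric] by linarith
  qed
  then have A_le: "A \<le> 2 * F 0 / \<eta> + 8 * m + (2 * L * \<eta> + 16 * m) * ln (b T / b0)"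
    by (simp add: K_def K'_def distrib_right mult.assoc)
  have a_le: "a t \<le> 2 * (b T + m)" if t: "t < T" for t
  proof (rule power2_le_imp_le)
    have nm: "n t \<le> m" using noise_le t by blast
    have "p t - n t \<le> q t" by (rule power2_le_imp_le[OF noise_reverse_triangle q_nonneg])
    then have "(p t)\<^sup>2 \<le> (q t + m)\<^sup>2" using nm p_nonneg[of t] by (intro power_mono) auto
    also have "\<dots> \<le> 2 * (q t)\<^sup>2 + 2 * m\<^sup>2"
      using zero_le_power2[of "q t - m"] by (simp add: power2_sum power2_diff)
    finally have "(a t)\<^sup>2 \<le> 2 * (b (Suc t))\<^sup>2 + 3 * m\<^sup>2"
      using a_sq[of t] b_Suc_sq[of t] zero_le_power2[of "b t"] by linarith
    moreover have "(b (Suc t))\<^sup>2 \<le> (b T)\<^sup>2"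
      using t b_mono[of "Suc t" T] b_pos[of "Suc t"] by (intro power_mono) auto
    moreover have "(2 * (b T + m))\<^sup>2 = 4 * (b T)\<^sup>2 + 8 * (b T * m) + 4 * m\<^sup>2"
      by (simp add: power2_eq_square algebra_simps)
    moreover have "0 \<le> b T * m" using b_pos[of T] m by simp
    ultimately show "(a t)\<^sup>2 \<le> (2 * (b T + m))\<^sup>2"
      using zero_le_power2[of "b T"] zero_le_power2[of m] by linarith
  qed (use b_pos[of T] m in simp)
  have "a t * ((p t)\<^sup>2 / a t) = (p t)\<^sup>2" for t using a_pos[of t] by simp
  then have "(\<Sum>t<T. (p t)\<^sup>2) = (\<Sum>t<T. a t * ((p t)\<^sup>2 / a t))" by simp
  also have "\<dots> \<le> (\<Sum>t<T. 2 * (b T + m) * ((p t)\<^sup>2 / a t))"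
  proof (intro sum_mono mult_right_mono)
    fix t assume "t \<in> {..<T}"
    then show "a t \<le> 2 * (b T + m)" "0 \<le> (p t)\<^sup>2 / a t" using a_le a_pos[of t] by auto
  qed
  also have "\<dots> = 2 * (b T + m) * A" unfolding A_def by (rule sum_distrib_left[symmetric])
  also have "\<dots> \<le> 2 * (b T + m) * (2 * F 0 / \<eta> + 8 * m + (2 * L * \<eta> + 16 * m) * ln (b T / b0))"
    by (rule mult_left_mono[OF A_le]) (use b_pos[of T] m in simp)
  finally show ?thesis .
qed

end

section \<open>The run as a function of independent samples\<close>

text \<open>
  The algorithm as a deterministic function of the sample sequence, which makes its dependence on
  the past explicit.  The second component carries the current \<open>b\<close>.
\<close>

primrec adagrad_state :: "nat \<Rightarrow> real \<Rightarrow> real \<Rightarrow> (nat \<Rightarrow> real) \<Rightarrow> ((nat \<Rightarrow> real) \<Rightarrow> 'z \<Rightarrow> (nat \<Rightarrow> real))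
    \<Rightarrow> (nat \<Rightarrow> 'z) \<Rightarrow> nat \<Rightarrow> (nat \<Rightarrow> real) \<times> real" where
  "adagrad_state d \<eta> b0 x1 G z 0 = (x1, b0)"
| "adagrad_state d \<eta> b0 x1 G z (Suc t) =
     (let (x, b) = adagrad_state d \<eta> b0 x1 G z t;
          g = G x (z (Suc t));
          b' = sqrt (b\<^sup>2 + (Rd_norm d g)\<^sup>2)
      in (\<lambda>i\<in>{..<d}. x i - \<eta> / b' * g i, b'))"

lemma adagrad_state_cong:
  "(\<And>i. i \<in> {1..t} \<Longrightarrow> z i = z' i) \<Longrightarrow> adagrad_state d \<eta> b0 x1 G z t = adagrad_state d \<eta> b0 x1 G z' t"
proof (induction t)
  case (Suc t)
  then have "adagrad_state d \<eta> b0 x1 G z t = adagrad_state d \<eta> b0 x1 G z' t" "z (Suc t) = z' (Suc t)"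
    by auto
  then show ?case by simp
qed simp

lemma adagrad_run_eq_state:
  assumes run: "adagrad_norm_run d \<eta> b0 x1 T (\<lambda>t. G (x t) (z t)) x" and b0: "b0 > 0" and "t \<le> T"
  shows "adagrad_state d \<eta> b0 x1 G z t = (x (Suc t), adagrad_b d b0 (\<lambda>t. G (x t) (z t)) t)"
  using \<open>t \<le> T\<close>
proof (induction t)
  case 0
  then show ?case using run b0 by (simp add: adagrad_norm_run_def adagrad_b_def)
next
  case (Suc t)
  let ?b = "adagrad_b d b0 (\<lambda>t. G (x t) (z t))"
  have "(?b t)\<^sup>2 + (Rd_norm d (G (x (Suc t)) (z (Suc t))))\<^sup>2
      = b0\<^sup>2 + (\<Sum>i=1..Suc t. (Rd_norm d (G (x i) (z i)))\<^sup>2)"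
    by (simp add: adagrad_b_def sum_nonneg)
  then have b: "sqrt ((?b t)\<^sup>2 + (Rd_norm d (G (x (Suc t)) (z (Suc t))))\<^sup>2) = ?b (Suc t)"
    by (simp only: adagrad_b_def)
  have x: "x (Suc (Suc t)) = (\<lambda>i\<in>{..<d}. x (Suc t) i - \<eta> / ?b (Suc t) * G (x (Suc t)) (z (Suc t)) i)"
    using run Suc.prems unfolding adagrad_norm_run_def by auto
  have "adagrad_state d \<eta> b0 x1 G z t = (x (Suc t), ?b t)" using Suc by simp
  then show ?case by (simp only: adagrad_state.simps prod.case Let_def b x)
qed

lemma space_Rd_borel: "space (Rd_borel d) = Rd d"
  by (simp add: Rd_borel_def Rd_def space_PiM)

lemma measurable_Rd_coord:
  assumes "v \<in> N \<rightarrow>\<^sub>M Rd_borel d" "i < d"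
  shows "(\<lambda>w. v w i) \<in> borel_measurable N"
  using measurable_compose[OF assms(1)[unfolded Rd_borel_def] measurable_component_singleton] assms(2)
  by simp

lemma measurable_Rd_norm:
  assumes "\<And>i. i < d \<Longrightarrow> (\<lambda>w. v w i) \<in> borel_measurable N"
  shows "(\<lambda>w. Rd_norm d (v w)) \<in> borel_measurable N"
  unfolding Rd_norm_def L2_set_def using assms by simp

text \<open>
  The probabilistic setting, on the canonical space: the sample sequence \<open>z\<close> is drawn from a
  finite product of copies of \<open>D\<close>, indexed from \<open>1\<close>, and sample \<open>t + 1\<close> is used at step \<open>t\<close>.
\<close>

locale adagrad_oracle =
  fixes d :: nat and L :: real and f and gradf and fstar :: real
    and D :: "'z measure" and G and \<sigma> \<eta> b0 :: real and x1
  assumes d_pos: "d \<ge> 1" and smooth: "L_smooth d L f gradf"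
    and lower: "\<And>y. y \<in> Rd d \<Longrightarrow> fstar \<le> f y"
    and sg_grad: "gradient_oracle d gradf \<sigma> D G" and sigma_pos: "\<sigma> > 0"
    and x1_Rd: "x1 \<in> Rd d" and eta_pos: "\<eta> > 0" and b0_pos: "b0 > 0"
begin

abbreviation "samples m \<equiv> \<Pi>\<^sub>M i\<in>{1..m::nat}. D"
abbreviation "state \<equiv> adagrad_state d \<eta> b0 x1 G"
definition "X t z = fst (state z t)"
definition "B t z = snd (state z t)"
definition "ghat t z = G (X t z) (z (Suc t))"
definition "grad_norm t z = Rd_norm d (gradf (X t z))"
definition "answer_norm t z = Rd_norm d (ghat t z)"
definition "noise_norm t z = Rd_dist d (ghat t z) (gradf (X t z))"
definition "inner_noise t z = (\<Sum>i<d. gradf (X t z) i * (ghat t z i - gradf (X t z) i))"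

lemma D_prob: "prob_space D"
  using sg_grad by (simp add: gradient_oracle_def)

lemma L_nonneg: "L \<ge> 0"
  by (rule L_smooth_L_nonneg[OF smooth d_pos])

lemma X_0: "X 0 z = x1" and B_0: "B 0 z = b0"
  by (simp_all add: X_def B_def)

lemma B_Suc: "B (Suc t) z = sqrt ((B t z)\<^sup>2 + (answer_norm t z)\<^sup>2)"
  by (simp add: B_def X_def ghat_def answer_norm_def case_prod_beta Let_def)

lemma X_Suc: "X (Suc t) z = (\<lambda>i\<in>{..<d}. X t z i - \<eta> / B (Suc t) z * ghat t z i)"
  by (simp add: B_def X_def ghat_def case_prod_beta Let_def)

lemma X_Rd: "X t z \<in> Rd d"
  by (cases t) (simp_all add: X_0 x1_Rd X_Suc restrict_in_Rd)

lemma path: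
  "adagrad_path \<eta> L b0 (\<lambda>t. grad_norm t z) (\<lambda>t. answer_norm t z) (\<lambda>t. noise_norm t z)
     (\<lambda>t. inner_noise t z) (\<lambda>t. f (X t z) - fstar) (\<lambda>t. B t z)"
proof
  fix t
  let ?g = "gradf (X t z)" and ?h = "ghat t z"
  have inner: "(\<Sum>i<d. ?g i * ?h i) = (grad_norm t z)\<^sup>2 + inner_noise t z"
    unfolding grad_norm_def Rd_norm_sq inner_noise_def sum.distrib[symmetric]
    by (rule sum.cong) (auto simp: power2_eq_square algebra_simps)
  show "(answer_norm t z)\<^sup>2 = (grad_norm t z)\<^sup>2 + 2 * inner_noise t z + (noise_norm t z)\<^sup>2"
    unfolding answer_norm_def grad_norm_def noise_norm_def Rd_dist_def Rd_norm_sq inner_noise_def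
      sum_distrib_left sum.distrib[symmetric]
    by (rule sum.cong) (auto simp: power2_eq_square algebra_simps)
  show "\<bar>inner_noise t z\<bar> \<le> grad_norm t z * noise_norm t z"
    unfolding inner_noise_def grad_norm_def noise_norm_def Rd_dist_def by (rule Rd_inner_le)
  show "\<bar>(grad_norm t z)\<^sup>2 + inner_noise t z\<bar> \<le> grad_norm t z * answer_norm t z"
    using Rd_inner_le[where d=d and u="?g" and v="?h"] unfolding inner[symmetric] by (simp only: grad_norm_def answer_norm_def)
  define c where "c = \<eta> / B (Suc t) z"
  have "X (Suc t) z = (\<lambda>i\<in>{..<d}. X t z i + - c * ?h i)"
    unfolding X_Suc c_def by (simp add: restrict_def fun_eq_iff)
  then have "f (X (Suc t) z) \<le> f (X t z) + (\<Sum>i<d. ?g i * (- c * ?h i)) + L / 2 * (Rd_norm d (\<lambda>i. - c * ?h i))\<^sup>2"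
    using descent_inequality[OF smooth X_Rd, of t z "\<lambda>i. - c * ?h i"] by simp
  also have "(\<Sum>i<d. ?g i * (- c * ?h i)) = - c * (\<Sum>i<d. ?g i * ?h i)"
    unfolding sum_distrib_left by (rule sum.cong) auto
  also have "(Rd_norm d (\<lambda>i. - c * ?h i))\<^sup>2 = c\<^sup>2 * (answer_norm t z)\<^sup>2"
    unfolding Rd_norm_scale power_mult_distrib answer_norm_def by simp
  finally have "f (X (Suc t) z) \<le> f (X t z) - c * ((grad_norm t z)\<^sup>2 + inner_noise t z)
      + L / 2 * (c\<^sup>2 * (answer_norm t z)\<^sup>2)" unfolding inner by simp
  also have "\<dots> = f (X t z) - \<eta> * (((grad_norm t z)\<^sup>2 + inner_noise t z) / B (Suc t) z)
      + L * \<eta>\<^sup>2 / 2 * ((answer_norm t z)\<^sup>2 / (B (Suc t) z)\<^sup>2)"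
    unfolding c_def by (simp add: power_divide)
  finally show "f (X (Suc t) z) - fstar \<le> f (X t z) - fstar
      - \<eta> * (((grad_norm t z)\<^sup>2 + inner_noise t z) / B (Suc t) z)
      + L * \<eta>\<^sup>2 / 2 * ((answer_norm t z)\<^sup>2 / (B (Suc t) z)\<^sup>2)" by simp
  show "0 \<le> f (X t z) - fstar" using lower[OF X_Rd] by simp
qed (simp_all add: eta_pos b0_pos L_nonneg B_0 B_Suc grad_norm_def answer_norm_def noise_norm_def
      Rd_dist_def Rd_norm_nonneg)

lemma oracle_measurable: "(\<lambda>(x, y). G x y) \<in> (Rd_borel d \<Otimes>\<^sub>M D) \<rightarrow>\<^sub>M Rd_borel d"
  using sg_grad by (simp add: gradient_oracle_def)

text \<open>
  By unbiasedness the gradient is a parameter integral of the jointly measurable answers, so Fubini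
  makes it measurable.
\<close>

lemma gradf_measurable:
  assumes "i < d"
  shows "(\<lambda>x. gradf x i) \<in> borel_measurable (Rd_borel d)"
proof -
  interpret prob_space D by (rule D_prob)
  have "(\<lambda>w. (case w of (x, y) \<Rightarrow> G x y) i) \<in> borel_measurable (Rd_borel d \<Otimes>\<^sub>M D)"
    by (rule measurable_Rd_coord[OF oracle_measurable assms])
  then have "(\<lambda>x. \<integral>y. G x y i \<partial>D) \<in> borel_measurable (Rd_borel d)"
    by (intro borel_measurable_lebesgue_integral) (simp add: case_prod_beta)
  then show ?thesis
    by (rule measurable_cong[THEN iffD1, rotated])
      (use sg_grad assms in \<open>simp add: gradient_oracle_def space_Rd_borel\<close>)
qed

lemma state_measurable:
  "t \<le> m \<Longrightarrow> X t \<in> samples m \<rightarrow>\<^sub>M Rd_borel d \<and> B t \<in> borel_measurable (samples m)"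
  and ghat_measurable: "t < m \<Longrightarrow> ghat t \<in> samples m \<rightarrow>\<^sub>M Rd_borel d"
proof -
  have ghat: "ghat t \<in> samples m \<rightarrow>\<^sub>M Rd_borel d"
    if "t < m" and [measurable]: "X t \<in> samples m \<rightarrow>\<^sub>M Rd_borel d" for t
  proof -
    have [measurable]: "(\<lambda>z. z (Suc t)) \<in> samples m \<rightarrow>\<^sub>M D"
      using that(1) by (intro measurable_component_singleton) auto
    have "(\<lambda>z. (X t z, z (Suc t))) \<in> samples m \<rightarrow>\<^sub>M Rd_borel d \<Otimes>\<^sub>M D" by measurable
    from measurable_compose[OF this oracle_measurable] show ?thesis
      by (simp add: ghat_def[abs_def])
  qed
  have *: "X t \<in> samples m \<rightarrow>\<^sub>M Rd_borel d \<and> B t \<in> borel_measurable (samples m)" if "t \<le> m" for t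
    using that
  proof (induction t)
    case 0
    have "x1 \<in> space (Rd_borel d)" using x1_Rd by (simp add: space_Rd_borel)
    then show ?case by (simp add: X_0[abs_def] B_0[abs_def] measurable_const)
  next
    case (Suc t)
    then have X: "X t \<in> samples m \<rightarrow>\<^sub>M Rd_borel d" and [measurable]: "B t \<in> borel_measurable (samples m)"
      by auto
    have g: "ghat t \<in> samples m \<rightarrow>\<^sub>M Rd_borel d" using ghat X Suc.prems by auto
    have [measurable]: "(\<lambda>z. answer_norm t z) \<in> borel_measurable (samples m)"
      unfolding answer_norm_def by (intro measurable_Rd_norm measurable_Rd_coord[OF g])
    have B: "B (Suc t) \<in> borel_measurable (samples m)" unfolding B_Suc[abs_def] by measurable
    have "X (Suc t) \<in> samples m \<rightarrow>\<^sub>M Rd_borel d"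
      unfolding X_Suc[abs_def] Rd_borel_def
      by (intro measurable_restrict borel_measurable_diff borel_measurable_times borel_measurable_divide
          measurable_Rd_coord[OF X] measurable_Rd_coord[OF g] B borel_measurable_const) auto
    with B show ?case by simp
  qed
  show "t \<le> m \<Longrightarrow> X t \<in> samples m \<rightarrow>\<^sub>M Rd_borel d \<and> B t \<in> borel_measurable (samples m)" by (rule *)
  show "t < m \<Longrightarrow> ghat t \<in> samples m \<rightarrow>\<^sub>M Rd_borel d" using ghat * by simp
qed

lemma gradf_X_measurable:
  assumes "t \<le> m" "i < d"
  shows "(\<lambda>z. gradf (X t z) i) \<in> borel_measurable (samples m)"
  using measurable_compose[OF _ gradf_measurable[OF assms(2)], of "X t"] state_measurable assms(1) by blast

lemma quantities_measurable:
  assumes "t < m"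
  shows "grad_norm t \<in> borel_measurable (samples m)" "noise_norm t \<in> borel_measurable (samples m)"
    "inner_noise t \<in> borel_measurable (samples m)" "B t \<in> borel_measurable (samples m)"
proof -
  note m = gradf_X_measurable[of t m] measurable_Rd_coord[OF ghat_measurable[OF assms]]
  show "grad_norm t \<in> borel_measurable (samples m)"
    unfolding grad_norm_def[abs_def] using assms by (intro measurable_Rd_norm m) auto
  show "noise_norm t \<in> borel_measurable (samples m)"
    unfolding noise_norm_def[abs_def] Rd_dist_def using assms
    by (intro measurable_Rd_norm borel_measurable_diff m) auto
  show "inner_noise t \<in> borel_measurable (samples m)"
    unfolding inner_noise_def[abs_def] using assms
    by (intro borel_measurable_sum borel_measurable_times borel_measurable_diff m) auto
  show "B t \<in> borel_measurable (samples m)" using state_measurable[of t m] assms by simp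
qed

lemma state_local:
  assumes "t < k"
  shows "X t (z(k := y)) = X t z" "B t (z(k := y)) = B t z" "grad_norm t (z(k := y)) = grad_norm t z"
proof -
  have "state (z(k := y)) t = state z t" using assms by (intro adagrad_state_cong) auto
  then show "X t (z(k := y)) = X t z" "B t (z(k := y)) = B t z" "grad_norm t (z(k := y)) = grad_norm t z"
    by (simp_all add: X_def B_def grad_norm_def)
qed

lemma ghat_fresh: "ghat t (z(Suc t := y)) = G (X t z) y"
  by (simp add: ghat_def state_local)

lemma ghat_local: "Suc t < k \<Longrightarrow> ghat t (z(k := y)) = ghat t z"
  by (simp add: ghat_def state_local)

lemma fresh_factors_noise_sq:
  "fresh_factors D T (\<lambda>t z. if t \<in> S then (noise_norm t z)\<^sup>2 / \<sigma>\<^sup>2 - 1 else 0)"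
  unfolding fresh_factors_def
proof (intro conjI allI impI ballI)
  fix t m :: nat assume "t < m" "m \<le> T"
  note [measurable] = quantities_measurable[OF \<open>t < m\<close>]
  show "(\<lambda>z. if t \<in> S then (noise_norm t z)\<^sup>2 / \<sigma>\<^sup>2 - 1 else 0) \<in> borel_measurable (samples m)"
    by measurable
next
  fix t k :: nat and z :: "nat \<Rightarrow> 'z" and y assume "Suc t < k"
  then show "(if t \<in> S then (noise_norm t (z(k := y)))\<^sup>2 / \<sigma>\<^sup>2 - 1 else 0)
      = (if t \<in> S then (noise_norm t z)\<^sup>2 / \<sigma>\<^sup>2 - 1 else 0)"
    by (simp add: noise_norm_def ghat_local state_local)
next
  fix t and z :: "nat \<Rightarrow> 'z"
  have sg: "sub_gaussian D \<sigma> (\<lambda>y. Rd_dist d (G (X t z) y) (gradf (X t z)))"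
    using sg_grad X_Rd by (simp add: gradient_oracle_def)
  show "(\<integral>\<^sup>+y. ennreal (exp (if t \<in> S then (noise_norm t (z(Suc t := y)))\<^sup>2 / \<sigma>\<^sup>2 - 1 else 0)) \<partial>D) \<le> 1"
  proof (cases "t \<in> S")
    case True
    have "noise_norm t (z(Suc t := y)) = Rd_dist d (G (X t z) y) (gradf (X t z))" for y
      by (simp add: noise_norm_def ghat_fresh state_local)
    then show ?thesis using sub_gaussian_square_mgf[OF D_prob sigma_pos sg] True by simp
  next
    case False
    then show ?thesis using prob_space.emeasure_space_1[OF D_prob] by simp
  qed
qed

text \<open>
  The weight \<open>w\<close> is a function of quantities known before the noise is drawn, so conditionally on
  the past the inner product is centred and \<open>sub_gaussian_linear_mgf\<close> applies.
\<close>

lemma fresh_factors_inner_noise: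
  assumes w: "(\<lambda>(p, b). w p b) \<in> borel_measurable (borel \<Otimes>\<^sub>M borel)"
  shows "fresh_factors D T (\<lambda>t z. w (grad_norm t z) (B t z) * inner_noise t z
           - (w (grad_norm t z) (B t z))\<^sup>2 * (grad_norm t z)\<^sup>2 * \<sigma>\<^sup>2)"
  unfolding fresh_factors_def
proof (intro conjI allI impI ballI)
  fix t m :: nat assume "t < m" "m \<le> T"
  note [measurable] = quantities_measurable[OF \<open>t < m\<close>]
  have "(\<lambda>z. (grad_norm t z, B t z)) \<in> samples m \<rightarrow>\<^sub>M borel \<Otimes>\<^sub>M borel" by measurable
  from measurable_compose[OF this w]
  have [measurable]: "(\<lambda>z. w (grad_norm t z) (B t z)) \<in> borel_measurable (samples m)" by simp
  show "(\<lambda>z. w (grad_norm t z) (B t z) * inner_noise t z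
      - (w (grad_norm t z) (B t z))\<^sup>2 * (grad_norm t z)\<^sup>2 * \<sigma>\<^sup>2) \<in> borel_measurable (samples m)"
    by measurable
next
  fix t k :: nat and z :: "nat \<Rightarrow> 'z" and y assume "Suc t < k"
  then show "w (grad_norm t (z(k := y))) (B t (z(k := y))) * inner_noise t (z(k := y))
      - (w (grad_norm t (z(k := y))) (B t (z(k := y))))\<^sup>2 * (grad_norm t (z(k := y)))\<^sup>2 * \<sigma>\<^sup>2
    = w (grad_norm t z) (B t z) * inner_noise t z
      - (w (grad_norm t z) (B t z))\<^sup>2 * (grad_norm t z)\<^sup>2 * \<sigma>\<^sup>2"
    by (simp add: inner_noise_def ghat_local state_local)
next
  fix t and z :: "nat \<Rightarrow> 'z"
  interpret D: prob_space D by (rule D_prob)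
  let ?x = "X t z" and ?p = "grad_norm t z"
  define c where "c = w ?p (B t z)"
  define l where "l = \<bar>c\<bar> * ?p"
  define E where "E y = c * (\<Sum>i<d. gradf ?x i * (G ?x y i - gradf ?x i))" for y
  have int: "integrable D (\<lambda>y. G ?x y i)" "(\<integral>y. G ?x y i \<partial>D) = gradf ?x i" if "i < d" for i
    using sg_grad X_Rd that by (simp_all add: gradient_oracle_def)
  have sg: "sub_gaussian D \<sigma> (\<lambda>y. Rd_dist d (G ?x y) (gradf ?x))"
    using sg_grad X_Rd by (simp add: gradient_oracle_def)
  have "(\<integral>\<^sup>+y. ennreal (exp (E y - l\<^sup>2 * \<sigma>\<^sup>2)) \<partial>D) \<le> 1"
  proof (rule sub_gaussian_linear_mgf[OF D_prob sigma_pos sg])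
    have int_i: "integrable D (\<lambda>y. gradf ?x i * (G ?x y i - gradf ?x i))"
      "(\<integral>y. gradf ?x i * (G ?x y i - gradf ?x i) \<partial>D) = 0" if "i \<in> {..<d}" for i
      using int that by (simp_all add: D.prob_space)
    show "integrable D E" unfolding E_def
      by (intro integrable_mult_right Bochner_Integration.integrable_sum int_i(1))
    have "(\<integral>y. E y \<partial>D) = c * (\<Sum>i<d. \<integral>y. gradf ?x i * (G ?x y i - gradf ?x i) \<partial>D)"
      unfolding E_def using Bochner_Integration.integral_sum[of "{..<d}", OF int_i(1)] by simp
    also have "(\<Sum>i<d. \<integral>y. gradf ?x i * (G ?x y i - gradf ?x i) \<partial>D) = 0"
      by (rule sum.neutral) (use int_i(2) in blast)
    finally show "(\<integral>y. E y \<partial>D) = 0" by simp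
    show "l \<ge> 0" by (simp add: l_def grad_norm_def Rd_norm_nonneg)
    fix y
    have "\<bar>E y\<bar> \<le> \<bar>c\<bar> * (Rd_norm d (gradf ?x) * Rd_norm d (\<lambda>i. G ?x y i - gradf ?x i))"
      unfolding E_def abs_mult by (intro mult_left_mono Rd_inner_le) simp
    then show "\<bar>E y\<bar> \<le> l * Rd_dist d (G ?x y) (gradf ?x)"
      by (simp add: l_def grad_norm_def Rd_dist_def mult.assoc)
  qed
  then show "(\<integral>\<^sup>+y. ennreal (exp (w (grad_norm t (z(Suc t := y))) (B t (z(Suc t := y))) * inner_noise t (z(Suc t := y))
      - (w (grad_norm t (z(Suc t := y))) (B t (z(Suc t := y))))\<^sup>2 * (grad_norm t (z(Suc t := y)))\<^sup>2 * \<sigma>\<^sup>2)) \<partial>D) \<le> 1"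
    by (simp add: inner_noise_def ghat_fresh state_local E_def c_def[symmetric] l_def power_mult_distrib)
qed

end

section \<open>The four good events\<close>

context adagrad_oracle
begin

text \<open>
  Four events of probability at most \<open>\<delta> / 4\<close> are excluded.  The two bounds on the noise come from the
  unit mean bound for \<open>exp (n\<^sup>2 / \<sigma>\<^sup>2 - 1)\<close>, accumulated over all steps for the first, and applied to each
  step with probability \<open>\<delta> / (4 T)\<close> for the maximum, whence \<open>1 + ln 4 + ln T\<close> in \<open>m\<close>.  For the lower
  bound on \<open>B\<close>, the inner product with the noise gets the constant weight \<open>- 1 / (4 \<sigma>\<^sup>2)\<close>: minus twice
  the accumulated inner product is then at most half the accumulated squared gradient norm plus
  \<open>8 \<sigma>\<^sup>2 l\<close>, at all times at once.  For the last bound, the weight is \<open>- \<mu> / a\<close> with \<open>a\<close> the square root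
  in the statement and \<open>\<mu> = m / (4 \<sigma>\<^sup>2)\<close>: then \<open>\<mu> \<sigma>\<^sup>2 / a \<le> 1 / 4\<close>, and \<open>l / \<mu> \<le> 4 m\<close> because
  \<open>\<sigma>\<^sup>2 l \<le> m\<^sup>2\<close>.
\<close>

lemma good_event:
  assumes T: "T \<ge> 1" and \<delta>: "0 < \<delta>" "\<delta> < 1"
  defines "l \<equiv> ln (1 / \<delta>) + ln 4"
    and "m \<equiv> \<sigma> * sqrt (1 + ln 4 + ln (real T) + ln (1 / \<delta>))"
  shows "\<exists>A\<in>sets (samples T). 1 - \<delta> \<le> measure (samples T) A \<and> (\<forall>z\<in>A.
      (\<Sum>t<T. (noise_norm t z)\<^sup>2) \<le> \<sigma>\<^sup>2 * (real T + l) \<and>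
      (\<forall>k\<le>T. b0\<^sup>2 + (\<Sum>t<k. (grad_norm t z)\<^sup>2) / 2 + (\<Sum>t<k. (noise_norm t z)\<^sup>2)
          \<le> (B k z)\<^sup>2 + 8 * \<sigma>\<^sup>2 * l) \<and>
      (\<forall>t<T. noise_norm t z \<le> m) \<and>
      - (\<Sum>t<T. inner_noise t z / sqrt ((B t z)\<^sup>2 + (grad_norm t z)\<^sup>2 + m\<^sup>2))
        \<le> (\<Sum>t<T. (grad_norm t z)\<^sup>2 / sqrt ((B t z)\<^sup>2 + (grad_norm t z)\<^sup>2 + m\<^sup>2)) / 4 + 4 * m)"
proof -
  interpret N: prob_space "samples T" by (intro prob_space_PiM D_prob)
  define \<epsilon> where "\<epsilon> = \<delta> / 4"
  have eps: "\<epsilon> > 0" "\<epsilon> / real T > 0" using \<delta> T by (simp_all add: \<epsilon>_def)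
  have ln_eps: "ln (1 / \<epsilon>) = l" "ln (1 / (\<epsilon> / real T)) = l + ln (real T)"
    using \<delta> T by (simp_all add: \<epsilon>_def l_def ln_div ln_mult)
  have ln_T: "0 \<le> ln (real T)" using T by simp
  have l0: "0 < l" unfolding l_def using \<delta> by (intro add_pos_pos) auto
  have m_sq: "m\<^sup>2 = \<sigma>\<^sup>2 * (1 + l + ln (real T))"
    using l0 ln_T unfolding m_def l_def by (simp add: power_mult_distrib)
  have m0: "m > 0" unfolding m_def using l0 ln_T sigma_pos by (simp add: l_def)
  have ml: "\<sigma>\<^sup>2 * l \<le> m * m"
    using mult_left_mono[of l "1 + l + ln (real T)" "\<sigma>\<^sup>2"] ln_T m_sq by (simp add: power2_eq_square)
  define \<mu> where "\<mu> = m / (4 * \<sigma>\<^sup>2)"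
  have mu0: "\<mu> > 0" using m0 sigma_pos by (simp add: \<mu>_def)
  define \<psi>1 where "\<psi>1 S t z = (if t \<in> S then (noise_norm t z)\<^sup>2 / \<sigma>\<^sup>2 - 1 else 0)" for S t z
  define \<psi>2 where "\<psi>2 w t z = w (grad_norm t z) (B t z) * inner_noise t z
      - (w (grad_norm t z) (B t z))\<^sup>2 * (grad_norm t z)\<^sup>2 * \<sigma>\<^sup>2" for w t z
  define w1 :: "real \<Rightarrow> real \<Rightarrow> real" where "w1 p b = - (1 / (4 * \<sigma>\<^sup>2))" for p b
  define w2 :: "real \<Rightarrow> real \<Rightarrow> real" where "w2 p b = - \<mu> / sqrt (b\<^sup>2 + p\<^sup>2 + m\<^sup>2)" for p b
  have fresh1: "fresh_factors D T (\<psi>1 S)" for S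
    unfolding \<psi>1_def[abs_def] by (rule fresh_factors_noise_sq)
  have w1: "(\<lambda>(p, b). w1 p b) \<in> borel_measurable (borel \<Otimes>\<^sub>M borel)"
    unfolding w1_def by simp
  have w2: "(\<lambda>(p, b). w2 p b) \<in> borel_measurable (borel \<Otimes>\<^sub>M borel)"
    unfolding w2_def by measurable
  have fresh2: "fresh_factors D T (\<psi>2 w1)" "fresh_factors D T (\<psi>2 w2)"
    unfolding \<psi>2_def[abs_def] by (rule fresh_factors_inner_noise w1 w2)+
  define Bad where "Bad c \<psi> = {z \<in> space (samples T). \<exists>k\<le>T. ln (1 / c) < (\<Sum>t<k. \<psi> t z)}"
    for c :: real and \<psi> :: "nat \<Rightarrow> (nat \<Rightarrow> 'z) \<Rightarrow> real"
  have Bad: "Bad c \<psi> \<in> sets (samples T)" "measure (samples T) (Bad c \<psi>) \<le> c"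
    if "c > 0" "fresh_factors D T \<psi>" for c \<psi>
    unfolding Bad_def by (rule fresh_factors_maximal[OF D_prob that(2,1)])+
  define E1 where "E1 = Bad \<epsilon> (\<psi>1 UNIV)"
  define E2 where "E2 = Bad \<epsilon> (\<psi>2 w1)"
  define E3 where "E3 = Bad \<epsilon> (\<psi>2 w2)"
  define E4 where "E4 = (\<Union>s<T. Bad (\<epsilon> / real T) (\<psi>1 {s}))"
  have sets: "E1 \<in> sets (samples T)" "E2 \<in> sets (samples T)" "E3 \<in> sets (samples T)"
    unfolding E1_def E2_def E3_def by (rule Bad(1)[OF eps(1)] fresh1 fresh2)+
  have sets4: "E4 \<in> sets (samples T)"
    unfolding E4_def by (rule sets.finite_UN) (simp, rule Bad(1)[OF eps(2) fresh1])
  have "measure (samples T) E4 \<le> (\<Sum>s<T. measure (samples T) (Bad (\<epsilon> / real T) (\<psi>1 {s})))"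
    unfolding E4_def
  proof (rule N.finite_measure_subadditive_finite)
    show "(\<lambda>s. Bad (\<epsilon> / real T) (\<psi>1 {s})) ` {..<T} \<subseteq> sets (samples T)"
      using Bad(1)[OF eps(2) fresh1] by blast
  qed simp
  also have "\<dots> \<le> (\<Sum>s<T. \<epsilon> / real T)" by (rule sum_mono) (rule Bad(2)[OF eps(2) fresh1])
  also have "\<dots> = \<epsilon>" using T by simp
  finally have m4: "measure (samples T) E4 \<le> \<epsilon>" .
  have m123: "measure (samples T) E1 \<le> \<epsilon>" "measure (samples T) E2 \<le> \<epsilon>" "measure (samples T) E3 \<le> \<epsilon>"
    unfolding E1_def E2_def E3_def by (rule Bad(2)[OF eps(1)] fresh1 fresh2)+
  define E where "E = E1 \<union> E2 \<union> E3 \<union> E4"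
  have E: "E \<in> sets (samples T)" unfolding E_def by (intro sets.Un sets sets4)
  have "measure (samples T) E \<le> measure (samples T) (E1 \<union> E2 \<union> E3) + measure (samples T) E4"
    unfolding E_def by (intro measure_Un_le sets.Un sets sets4)
  moreover have "measure (samples T) (E1 \<union> E2 \<union> E3) \<le> measure (samples T) (E1 \<union> E2) + measure (samples T) E3"
    by (intro measure_Un_le sets.Un sets)
  moreover have "measure (samples T) (E1 \<union> E2) \<le> measure (samples T) E1 + measure (samples T) E2"
    by (intro measure_Un_le sets)
  ultimately have mE: "measure (samples T) E \<le> \<delta>" using m123 m4 unfolding \<epsilon>_def by linarith
  show ?thesis
  proof (intro bexI conjI ballI)
    show "space (samples T) - E \<in> sets (samples T)" using E by simp
    show "1 - \<delta> \<le> measure (samples T) (space (samples T) - E)"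
      using mE unfolding N.prob_compl[OF E] by simp
    fix z assume z: "z \<in> space (samples T) - E"
    interpret path: adagrad_path \<eta> L b0 "\<lambda>t. grad_norm t z" "\<lambda>t. answer_norm t z" "\<lambda>t. noise_norm t z"
      "\<lambda>t. inner_noise t z" "\<lambda>t. f (X t z) - fstar" "\<lambda>t. B t z" by (rule path)
    have notBad: "(\<Sum>t<k. \<psi> t z) \<le> ln (1 / c)" if "z \<notin> Bad c \<psi>" "k \<le> T" for c \<psi> k
      using that z unfolding Bad_def by auto
    have "(\<Sum>t<T. \<psi>1 UNIV t z) \<le> l"
      using notBad[of \<epsilon> "\<psi>1 UNIV" T] z unfolding E_def E1_def ln_eps by auto
    then have "(\<Sum>t<T. (noise_norm t z)\<^sup>2) / \<sigma>\<^sup>2 \<le> real T + l"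
      by (simp add: \<psi>1_def sum_subtractf sum_divide_distrib)
    then show "(\<Sum>t<T. (noise_norm t z)\<^sup>2) \<le> \<sigma>\<^sup>2 * (real T + l)"
      using sigma_pos by (simp add: pos_divide_le_eq mult.commute)
    show "\<forall>k\<le>T. b0\<^sup>2 + (\<Sum>t<k. (grad_norm t z)\<^sup>2) / 2 + (\<Sum>t<k. (noise_norm t z)\<^sup>2)
          \<le> (B k z)\<^sup>2 + 8 * \<sigma>\<^sup>2 * l"
    proof (intro allI impI)
      fix k assume k: "k \<le> T"
      let ?U = "\<Sum>t<k. (grad_norm t z)\<^sup>2" and ?I = "\<Sum>t<k. inner_noise t z"
      have "(\<Sum>t<k. \<psi>2 w1 t z) \<le> l"
        using notBad[of \<epsilon> "\<psi>2 w1" k] z k unfolding E_def E2_def ln_eps by auto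
      moreover have "(\<Sum>t<k. \<psi>2 w1 t z) = - (1 / (4 * \<sigma>\<^sup>2)) * ?I - (1 / (4 * \<sigma>\<^sup>2))\<^sup>2 * \<sigma>\<^sup>2 * ?U"
        unfolding \<psi>2_def w1_def sum_subtractf sum_distrib_left
        by (intro arg_cong2[of _ _ _ _ "(-)"] sum.cong refl) (simp_all add: ac_simps)
      ultimately have "4 * \<sigma>\<^sup>2 * (- (1 / (4 * \<sigma>\<^sup>2)) * ?I - (1 / (4 * \<sigma>\<^sup>2))\<^sup>2 * \<sigma>\<^sup>2 * ?U) \<le> 4 * \<sigma>\<^sup>2 * l"
        by (intro mult_left_mono) auto
      moreover have "4 * \<sigma>\<^sup>2 * (- (1 / (4 * \<sigma>\<^sup>2)) * ?I - (1 / (4 * \<sigma>\<^sup>2))\<^sup>2 * \<sigma>\<^sup>2 * ?U) = - ?I - ?U / 4"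
        using sigma_pos by (simp add: right_diff_distrib power2_eq_square)
      ultimately show "b0\<^sup>2 + ?U / 2 + (\<Sum>t<k. (noise_norm t z)\<^sup>2) \<le> (B k z)\<^sup>2 + 8 * \<sigma>\<^sup>2 * l"
        using path.b_sq_expand[of k] by linarith
    qed
    show "\<forall>t<T. noise_norm t z \<le> m"
    proof (intro allI impI)
      fix s assume s: "s < T"
      have "(\<Sum>t<T. \<psi>1 {s} t z) \<le> l + ln (real T)"
        using notBad[of "\<epsilon> / real T" "\<psi>1 {s}" T] z s unfolding E_def E4_def ln_eps by auto
      moreover have "(\<Sum>t<T. \<psi>1 {s} t z) = (noise_norm s z)\<^sup>2 / \<sigma>\<^sup>2 - 1"
        unfolding \<psi>1_def using s by (simp add: if_distrib[symmetric] sum.delta cong: if_cong)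
      ultimately have "(noise_norm s z)\<^sup>2 / \<sigma>\<^sup>2 \<le> 1 + l + ln (real T)" by simp
      then have "(noise_norm s z)\<^sup>2 \<le> m\<^sup>2"
        using sigma_pos unfolding m_sq by (simp add: pos_divide_le_eq mult.commute)
      then show "noise_norm s z \<le> m" by (rule power2_le_imp_le) (use m0 in simp)
    qed
    define a where "a t = sqrt ((B t z)\<^sup>2 + (grad_norm t z)\<^sup>2 + m\<^sup>2)" for t
    let ?A = "\<Sum>t<T. (grad_norm t z)\<^sup>2 / a t" and ?I = "\<Sum>t<T. inner_noise t z / a t"
    have a_m: "m \<le> a t" for t unfolding a_def by (rule real_le_rsqrt) simp
    have a0: "0 < a t" for t using a_m[of t] m0 by linarith
    have "(\<Sum>t<T. \<psi>2 w2 t z) \<le> l"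
      using notBad[of \<epsilon> "\<psi>2 w2" T] z unfolding E_def E3_def ln_eps by auto
    moreover have "- \<mu> * (inner_noise t z / a t) - \<mu> / 4 * ((grad_norm t z)\<^sup>2 / a t) \<le> \<psi>2 w2 t z" for t
    proof -
      have "(grad_norm t z)\<^sup>2 / a t * (m / a t) \<le> (grad_norm t z)\<^sup>2 / a t * 1"
        using a_m[of t] a0[of t] by (intro mult_left_mono) auto
      then have "\<mu> / 4 * ((grad_norm t z)\<^sup>2 / a t * (m / a t)) \<le> \<mu> / 4 * ((grad_norm t z)\<^sup>2 / a t)"
        using mu0 by (intro mult_left_mono) auto
      moreover have "(- \<mu> / a t)\<^sup>2 * (grad_norm t z)\<^sup>2 * \<sigma>\<^sup>2 = \<mu> / 4 * ((grad_norm t z)\<^sup>2 / a t * (m / a t))"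
      proof -
        have "\<mu> * \<sigma>\<^sup>2 = m / 4" using sigma_pos by (simp add: \<mu>_def)
        have "(- \<mu> / a t)\<^sup>2 * (grad_norm t z)\<^sup>2 * \<sigma>\<^sup>2 = (\<mu> * \<sigma>\<^sup>2) * (\<mu> * (grad_norm t z)\<^sup>2 / (a t * a t))"
          by (simp add: power_divide) (simp add: power2_eq_square)
        then show ?thesis unfolding \<open>\<mu> * \<sigma>\<^sup>2 = m / 4\<close> by simp
      qed
      ultimately show ?thesis unfolding \<psi>2_def w2_def a_def[symmetric] by simp
    qed
    then have "(\<Sum>t<T. - \<mu> * (inner_noise t z / a t) - \<mu> / 4 * ((grad_norm t z)\<^sup>2 / a t)) \<le> (\<Sum>t<T. \<psi>2 w2 t z)"
      by (intro sum_mono)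
    then have "- \<mu> * ?I - \<mu> / 4 * ?A \<le> (\<Sum>t<T. \<psi>2 w2 t z)"
      unfolding sum_subtractf sum_distrib_left[symmetric] .
    ultimately have "\<mu> * (- ?I - ?A / 4) \<le> l" by (simp add: right_diff_distrib)
    also have "l \<le> \<mu> * (4 * m)"
      using ml sigma_pos unfolding \<mu>_def by (simp add: pos_le_divide_eq mult.commute)
    finally have "- ?I - ?A / 4 \<le> 4 * m" using mu0 by (simp only: mult_le_cancel_left_pos)
    then show "- (\<Sum>t<T. inner_noise t z / sqrt ((B t z)\<^sup>2 + (grad_norm t z)\<^sup>2 + m\<^sup>2))
        \<le> (\<Sum>t<T. (grad_norm t z)\<^sup>2 / sqrt ((B t z)\<^sup>2 + (grad_norm t z)\<^sup>2 + m\<^sup>2)) / 4 + 4 * m"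
      unfolding a_def by linarith
  qed
qed

end

section \<open>Absorbing all terms into the three scales\<close>

text \<open>
  The next two bounds make \<open>1 + L ln L\<close> positive and let it absorb every linear term in \<open>L\<close>,
  although \<open>L ln L\<close> itself may be negative.
\<close>

lemma mult_ln_ge: "L \<ge> 0 \<Longrightarrow> - (1 / 2) \<le> L * ln L" for L :: real
proof (cases "L = 0")
  case False
  assume "L \<ge> 0"
  then have L: "L > 0" using False by simp
  have "ln (1 / (2 * L)) \<le> 1 / (2 * L) - 1" using L by (intro ln_le_minus_one) simp
  then have "- ln 2 - ln L \<le> 1 / (2 * L) - 1" using L by (simp add: ln_div ln_mult)
  then have "1 - ln 2 - 1 / (2 * L) \<le> ln L" by linarith
  moreover have "ln 2 \<le> (1::real)" using ln_2_less_1 by simp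
  ultimately have "- (1 / (2 * L)) \<le> ln L" by linarith
  then have "L * - (1 / (2 * L)) \<le> L * ln L" using L by (intro mult_left_mono) auto
  then show ?thesis using L by simp
qed simp

lemma le_one_plus_mult_ln: "L \<ge> 0 \<Longrightarrow> L \<le> 1 + L * ln L" for L :: real
proof (cases "L = 0")
  case False
  assume "L \<ge> 0"
  then have L: "L > 0" using False by simp
  have "ln (1 / L) \<le> 1 / L - 1" using L by (intro ln_le_minus_one) simp
  then have "1 - 1 / L \<le> ln L" using L by (simp add: ln_div)
  then have "L * (1 - 1 / L) \<le> L * ln L" using L by (intro mult_left_mono) auto
  then show ?thesis using L by (simp add: right_diff_distrib)
qed simp

definition step_size_const :: "real \<Rightarrow> real \<Rightarrow> real" where
  "step_size_const \<eta> b0 = 2 * (8 * b0 + 41 + 24 / b0 + 2 / \<eta> + 2 * \<eta> * (1 + \<bar>ln (4 * \<eta> / b0)\<bar>))"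

lemma ln_4_le_2: "ln 4 \<le> (2::real)"
proof -
  have "ln (2\<^sup>2 :: real) = 2 * ln 2" by (subst ln_realpow) auto
  then show ?thesis using ln_2_less_1 by simp
qed

text \<open>
  Here \<open>h\<close> stands for \<open>ln (1 / \<delta>)\<close>, and \<open>Z\<close> is the scale \<open>\<sigma> \<surd>T + r\<close> up to a constant factor: all
  quantities that enter the bound on the step-size denominator are at most constant multiples of it.
\<close>

locale scale_terms =
  fixes \<eta> b0 L \<sigma> h \<Delta> :: real and T :: nat
  assumes eta: "\<eta> > 0" and b0: "b0 > 0" and L: "L \<ge> 0" and \<sigma>: "\<sigma> > 0" and h: "h > 0"
    and \<Delta>: "\<Delta> \<ge> 0" and T: "T \<ge> 1"
begin

definition "Z = \<sigma> * sqrt (real T) + (1 + \<Delta> + \<sigma>\<^sup>2 * h + L * ln L)"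

lemma Z_bounds: "1 / 2 \<le> Z" "L \<le> Z" "\<Delta> \<le> Z" "\<sigma> * sqrt (real T) \<le> Z" "\<sigma> \<le> Z" "\<sigma>\<^sup>2 * h \<le> Z"
    "L * ln L \<le> Z" "\<sigma> * sqrt h \<le> Z"
proof -
  have nn: "0 \<le> \<sigma> * sqrt (real T)" "0 \<le> \<sigma>\<^sup>2 * h" using \<sigma> h by auto
  note l = mult_ln_ge[OF L] le_one_plus_mult_ln[OF L]
  show "1 / 2 \<le> Z" "L \<le> Z" "\<Delta> \<le> Z" "\<sigma> * sqrt (real T) \<le> Z" "\<sigma>\<^sup>2 * h \<le> Z" "L * ln L \<le> Z"
    using nn l \<Delta> unfolding Z_def by linarith+
  have "\<sigma> * 1 \<le> \<sigma> * sqrt (real T)" using \<sigma> T by (intro mult_left_mono) auto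
  then show "\<sigma> \<le> Z" using nn l \<Delta> unfolding Z_def by linarith
  have "0 \<le> (1 - \<sigma> * sqrt h)\<^sup>2" by simp
  then have "2 * (\<sigma> * sqrt h) \<le> 1 + \<sigma>\<^sup>2 * h"
    using h by (simp add: power2_diff power_mult_distrib)
  then show "\<sigma> * sqrt h \<le> Z" using nn l \<Delta> unfolding Z_def by linarith
qed

lemma sigma_sqrt_log_le: "\<sigma> * sqrt (h + ln 4) \<le> 3 * Z"
proof -
  have "sqrt (h + ln 4) \<le> sqrt h + sqrt (ln 4)" using h by (intro sqrt_add_le_add_sqrt) auto
  also have "sqrt (ln 4) \<le> 2" using ln_4_le_2 by (intro real_le_lsqrt) auto
  finally have "\<sigma> * sqrt (h + ln 4) \<le> \<sigma> * (sqrt h + 2)" using \<sigma> by (intro mult_left_mono) auto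
  then show ?thesis using Z_bounds by (simp add: distrib_left)
qed

text \<open>
  The minimum comes from the two bounds on the damage done by the early steps.  For \<open>h \<ge> 1\<close> the
  additive constant \<open>ln 4\<close> is at most \<open>2 h\<close>, and the second argument is at most a multiple of \<open>\<sigma>\<^sup>2 h\<close>.
  For \<open>h < 1\<close> the first argument, at most a multiple of \<open>\<sigma> \<surd>T\<close>, takes over; a term \<open>\<sigma>\<^sup>2\<close>
  with a constant factor can exceed every multiple of \<open>Z\<close>.
\<close>

lemma transient_le:
  "min (2 * sqrt (real T * (8 * \<sigma>\<^sup>2 * (h + ln 4)))) (8 * \<sigma>\<^sup>2 * (h + ln 4) / (2 * b0)) \<le> (10 + 12 / b0) * Z"
proof (cases "h \<ge> 1")
  case True
  have "\<sigma>\<^sup>2 * (h + ln 4) \<le> \<sigma>\<^sup>2 * (3 * h)"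
    using True ln_4_le_2 by (intro mult_left_mono) auto
  then have "8 * \<sigma>\<^sup>2 * (h + ln 4) / (2 * b0) \<le> 24 * Z / (2 * b0)"
    using b0 Z_bounds(6) by (intro divide_right_mono) auto
  also have "\<dots> \<le> (10 + 12 / b0) * Z" using Z_bounds(1) b0 by (simp add: distrib_right)
  finally show ?thesis by (rule min.coboundedI2)
next
  case False
  have "8 * (h + ln 4) \<le> 5\<^sup>2" using False ln_4_le_2 by simp
  then have "sqrt (8 * (h + ln 4)) \<le> 5" by (intro real_le_lsqrt) (use h in auto)
  then have "2 * (\<sigma> * sqrt (real T)) * sqrt (8 * (h + ln 4)) \<le> 2 * Z * 5"
    using Z_bounds(1,4) \<sigma> h by (intro mult_mono) auto
  moreover have "sqrt (real T * (8 * \<sigma>\<^sup>2 * (h + ln 4))) = \<sigma> * sqrt (real T) * sqrt (8 * (h + ln 4))"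
  proof -
    have "real T * (8 * \<sigma>\<^sup>2 * (h + ln 4)) = \<sigma>\<^sup>2 * real T * (8 * (h + ln 4))" by simp
    then show ?thesis using \<sigma> by (simp only: real_sqrt_mult) simp
  qed
  ultimately have "2 * sqrt (real T * (8 * \<sigma>\<^sup>2 * (h + ln 4))) \<le> 10 * Z" by simp
  also have "\<dots> \<le> (10 + 12 / b0) * Z" using Z_bounds(1) b0 by (intro mult_right_mono) auto
  finally show ?thesis by (rule min.coboundedI1)
qed

text \<open>
  Since \<open>ln y \<le> y\<close>, the logarithm is absorbed by half of the quantity \<open>B\<close> being bounded, at the
  price of a term of order \<open>1 + L ln L\<close>.
\<close>

lemma log_term_le:
  assumes B: "B > 0"
  shows "2 * L * \<eta> * ln (B / b0) \<le> B / 2 + 2 * \<eta> * (1 + \<bar>ln (4 * \<eta> / b0)\<bar>) * Z"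
proof (cases "L = 0")
  case True
  then show ?thesis using B eta Z_bounds(1) by simp
next
  case False
  then have Lp: "L > 0" using L by simp
  have "ln (B / (4 * L * \<eta>)) \<le> B / (4 * L * \<eta>)"
    using ln_le_minus_one[of "B / (4 * L * \<eta>)"] B Lp eta by simp
  then have "2 * L * \<eta> * ln (B / (4 * L * \<eta>)) \<le> 2 * L * \<eta> * (B / (4 * L * \<eta>))"
    using Lp eta by (intro mult_left_mono) auto
  also have "\<dots> = B / 2" using Lp eta by simp
  finally have 1: "2 * L * \<eta> * ln (B / (4 * L * \<eta>)) \<le> B / 2" .
  have 2: "2 * \<eta> * (L * ln L) \<le> 2 * \<eta> * Z" using Z_bounds(7) eta by (intro mult_left_mono) auto
  have "L * ln (4 * \<eta> / b0) \<le> L * \<bar>ln (4 * \<eta> / b0)\<bar>" using L by (intro mult_left_mono) auto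
  also have "\<dots> \<le> Z * \<bar>ln (4 * \<eta> / b0)\<bar>" using Z_bounds(2) by (intro mult_right_mono) auto
  finally have 3: "2 * \<eta> * (L * ln (4 * \<eta> / b0)) \<le> 2 * \<eta> * (Z * \<bar>ln (4 * \<eta> / b0)\<bar>)"
    using eta by (intro mult_left_mono) auto
  have "ln (B / b0) = ln (B / (4 * L * \<eta>)) + ln L + ln (4 * \<eta> / b0)"
    using B Lp eta b0 by (simp add: ln_div ln_mult)
  then have "2 * L * \<eta> * ln (B / b0)
      = 2 * L * \<eta> * ln (B / (4 * L * \<eta>)) + 2 * \<eta> * (L * ln L) + 2 * \<eta> * (L * ln (4 * \<eta> / b0))"
    by (simp add: distrib_left ac_simps)
  also have "\<dots> \<le> B / 2 + 2 * \<eta> * Z + 2 * \<eta> * (Z * \<bar>ln (4 * \<eta> / b0)\<bar>)"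
    using 1 2 3 by (intro add_mono)
  also have "\<dots> = B / 2 + 2 * \<eta> * (1 + \<bar>ln (4 * \<eta> / b0)\<bar>) * Z"
    by (simp add: distrib_left distrib_right ac_simps)
  finally show ?thesis .
qed

lemma step_size_le:
  assumes B: "B > 0" and J: "J = 8 * \<sigma>\<^sup>2 * (h + ln 4)" and V: "V \<le> \<sigma>\<^sup>2 * (real T + (h + ln 4))"
    and implicit: "B \<le> b0 + sqrt J + 3 * sqrt (b0\<^sup>2 + V) + 2 * min (2 * sqrt (real T * J)) (J / (2 * b0))
      + 2 * \<Delta> / \<eta> + 2 * L * \<eta> * ln (B / b0)"
  shows "B \<le> step_size_const \<eta> b0 * Z"
proof -
  have b0_le: "b0 \<le> 2 * (b0 * Z)" using mult_left_mono[OF Z_bounds(1), of "2 * b0"] b0 by simp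
  have "sqrt J = sqrt 8 * (\<sigma> * sqrt (h + ln 4))"
    using \<sigma> unfolding J by (simp add: real_sqrt_mult)
  also have "\<dots> \<le> 3 * (3 * Z)"
  proof (rule mult_mono)
    show "sqrt 8 \<le> (3::real)" by (intro real_le_lsqrt) auto
  qed (use sigma_sqrt_log_le \<sigma> h in auto)
  finally have J_le: "sqrt J \<le> 9 * Z" by simp
  have "sqrt (b0\<^sup>2 + V) \<le> sqrt (b0\<^sup>2 + (\<sigma>\<^sup>2 * real T + \<sigma>\<^sup>2 * (h + ln 4)))"
    using V by (intro real_sqrt_le_mono) (simp add: distrib_left)
  also have "\<dots> \<le> sqrt (b0\<^sup>2) + (sqrt (\<sigma>\<^sup>2 * real T) + sqrt (\<sigma>\<^sup>2 * (h + ln 4)))"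
    using h by (intro order_trans[OF sqrt_add_le_add_sqrt] add_left_mono sqrt_add_le_add_sqrt) auto
  also have "\<dots> = b0 + \<sigma> * sqrt (real T) + \<sigma> * sqrt (h + ln 4)"
    using b0 \<sigma> by (simp add: real_sqrt_mult)
  finally have V_le: "sqrt (b0\<^sup>2 + V) \<le> 2 * (b0 * Z) + 4 * Z"
    using b0_le Z_bounds(4) sigma_sqrt_log_le by linarith
  have \<Delta>_le: "2 * \<Delta> / \<eta> \<le> 2 * (Z / \<eta>)"
    using divide_right_mono[OF Z_bounds(3), of \<eta>] eta by simp
  define P where "P = min (2 * sqrt (real T * J)) (J / (2 * b0))"
  define E where "E = 2 * \<eta> * (1 + \<bar>ln (4 * \<eta> / b0)\<bar>)"
  have P_le: "P \<le> 10 * Z + 12 * (Z / b0)"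
    using transient_le unfolding P_def J by (simp add: distrib_right)
  have "B \<le> 8 * (b0 * Z) + 21 * Z + 2 * P + 2 * (Z / \<eta>) + (B / 2 + E * Z)"
    using implicit[folded P_def] b0_le J_le V_le \<Delta>_le log_term_le[OF B, folded E_def] by linarith
  then have "B \<le> 16 * (b0 * Z) + 82 * Z + 48 * (Z / b0) + 4 * (Z / \<eta>) + 2 * (E * Z)"
    using P_le by linarith
  also have "\<dots> = step_size_const \<eta> b0 * Z"
    unfolding step_size_const_def E_def[symmetric] by (simp add: distrib_right distrib_left)
  finally show ?thesis .
qed

lemma noise_max_le: "\<sigma> * sqrt (1 + ln 4 + ln (real T) + h) \<le> 3 * Z"
proof -
  have "ln (real T) \<le> real T - 1" using T by (intro ln_le_minus_one) auto
  then have "1 + ln 4 + ln (real T) + h \<le> 4 * real T + h" using ln_4_le_2 T by linarith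
  then have "sqrt (1 + ln 4 + ln (real T) + h) \<le> sqrt (4 * real T + h)" by simp
  also have "\<dots> \<le> sqrt (4 * real T) + sqrt h" using h by (intro sqrt_add_le_add_sqrt) auto
  finally have "\<sigma> * sqrt (1 + ln 4 + ln (real T) + h) \<le> \<sigma> * (2 * sqrt (real T) + sqrt h)"
    using \<sigma> by (intro mult_left_mono) (auto simp: real_sqrt_mult)
  then show ?thesis using Z_bounds by (simp add: distrib_left)
qed

text \<open>
  For \<open>T \<ge> 2\<close> the quantity \<open>ln (T / \<delta>)\<close> is bounded away from zero and dominates all constants up to a factor.
\<close>

lemma noise_max_le_log:
  assumes "T \<ge> 2"
  shows "\<sigma> * sqrt (1 + ln 4 + ln (real T) + h) \<le> 3 * \<sigma> * sqrt (ln (real T) + h)"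
proof -
  have "1 / 2 \<le> ln (2::real)" using ln_le_minus_one[of "1 / 2 :: real"] by (simp add: ln_div)
  also have "\<dots> \<le> ln (real T)" using assms by simp
  finally have "1 + ln 4 + ln (real T) + h \<le> 9 * (ln (real T) + h)" 
    using ln_4_le_2 h unfolding distrib_left by linarith
  then have "sqrt (1 + ln 4 + ln (real T) + h) \<le> sqrt (9 * (ln (real T) + h))" by simp
  also have "\<dots> = 3 * sqrt (ln (real T) + h)" unfolding real_sqrt_mult by simp
  finally show ?thesis using \<sigma> by simp
qed

end

context scale_terms
begin

text \<open>
  The constant in \<open>r\<close> is chosen so large that \<open>W \<ge> 3\<close> and \<open>W \<ge> step_size_const \<eta> b0 / b0\<close>.  The
  first makes \<open>ln W \<ge> 1\<close>, so that it absorbs additive constants; with the second, \<open>B / b0 \<le> W\<^sup>2\<close> and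
  \<open>ln (B / b0) \<le> 2 ln W\<close>.
\<close>

lemma bound_in_polylog_terms:
  assumes T2: "T \<ge> 2" and B: "B \<ge> b0" "B \<le> step_size_const \<eta> b0 * Z"
    and m: "m = \<sigma> * sqrt (1 + ln 4 + ln (real T) + h)"
    and W: "W = \<sigma> * sqrt (real T) + (2 * (step_size_const \<eta> b0 / b0) + 6) * (1 + \<Delta> + \<sigma>\<^sup>2 * h + L * ln L)"
  shows "2 * (B + m) * (2 * \<Delta> / \<eta> + 8 * m + (2 * L * \<eta> + 16 * m) * ln (B / b0))
    \<le> 2 * (step_size_const \<eta> b0 + 3) * W *
        ((2 / \<eta> + 4 * \<eta> + 120) * (\<Delta> + \<sigma> * ln W * sqrt (ln (real T) + h) + L * ln W))"
proof -
  define K where "K = step_size_const \<eta> b0"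
  define R where "R = 1 + \<Delta> + \<sigma>\<^sup>2 * h + L * ln L"
  define y where "y = \<sigma> * sqrt (ln (real T) + h)"
  have K: "K \<ge> 0" unfolding K_def step_size_const_def using eta b0 by simp
  have "0 \<le> \<sigma>\<^sup>2 * h" using h by simp
  then have R: "R \<ge> 1 / 2" unfolding R_def using mult_ln_ge[OF L] \<Delta> by linarith
  have Z: "Z = \<sigma> * sqrt (real T) + R" by (simp add: Z_def R_def)
  have W': "W = \<sigma> * sqrt (real T) + (2 * (K / b0) + 6) * R" unfolding W K_def R_def ..
  have sT: "0 \<le> \<sigma> * sqrt (real T)" using \<sigma> by simp
  have Kb: "0 \<le> K / b0" using K b0 by simp
  have "(2 * (K / b0) + 6) * (1 / 2) \<le> (2 * (K / b0) + 6) * R"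
    using R Kb by (intro mult_left_mono) auto
  moreover have "(2 * (K / b0) + 6) * (1 / 2) = K / b0 + 3" by (simp add: distrib_right)
  ultimately have W3: "3 \<le> W" and WK: "K / b0 \<le> W" using sT Kb unfolding W' by linarith+
  have "1 * R \<le> (2 * (K / b0) + 6) * R" using R Kb by (intro mult_right_mono) auto
  then have ZW: "Z \<le> W" unfolding Z W' by simp
  have lnW: "1 \<le> ln W" using W3 exp_le by (subst ln_ge_iff) auto
  have Z0: "0 \<le> Z" using Z_bounds(1) by simp
  have y0: "y \<ge> 0" unfolding y_def using \<sigma> T h by (simp add: ln_ge_zero)
  have my: "m \<le> 3 * y" using noise_max_le_log[OF T2] unfolding m y_def by simp
  have mZ: "m \<le> 3 * Z" using noise_max_le unfolding m .
  have ln_T: "0 \<le> ln (real T)" using T by simp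
  have m0: "0 \<le> m" unfolding m using \<sigma> h ln_T by simp
  have Bpos: "0 < B" using B b0 by simp
  have "B / b0 \<le> (K / b0) * Z" using B(2) b0 unfolding K_def[symmetric] by (simp add: divide_right_mono)
  also have "\<dots> \<le> W * W" using WK ZW Kb Z0 W3 by (intro mult_mono) auto
  finally have "ln (B / b0) \<le> ln (W * W)" using Bpos b0 by (intro ln_mono) auto
  also have "\<dots> = 2 * ln W" using W3 by (simp add: ln_mult)
  finally have lnB: "ln (B / b0) \<le> 2 * ln W" .
  have lnB0: "0 \<le> ln (B / b0)" using B(1) b0 by simp
  have "(2 * L * \<eta> + 16 * m) * ln (B / b0) \<le> (2 * L * \<eta> + 16 * (3 * y)) * (2 * ln W)"
    using my lnB lnB0 L eta y0 m0 by (intro mult_mono add_left_mono) auto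
  moreover have "8 * m \<le> 24 * (y * ln W)"
    using my mult_left_mono[OF lnW y0] by simp
  ultimately have "2 * \<Delta> / \<eta> + 8 * m + (2 * L * \<eta> + 16 * m) * ln (B / b0)
      \<le> 2 * \<Delta> / \<eta> + 24 * (y * ln W) + (2 * L * \<eta> + 16 * (3 * y)) * (2 * ln W)"
    by (intro add_mono) auto
  also have "\<dots> = 2 / \<eta> * \<Delta> + 120 * (y * ln W) + 4 * \<eta> * (L * ln W)"
    by (simp add: algebra_simps)
  also have "\<dots> \<le> (2 / \<eta> + 4 * \<eta> + 120) * \<Delta> + (2 / \<eta> + 4 * \<eta> + 120) * (y * ln W)
      + (2 / \<eta> + 4 * \<eta> + 120) * (L * ln W)"
    using eta \<Delta> L y0 lnW by (intro add_mono mult_right_mono) auto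
  also have "\<dots> = (2 / \<eta> + 4 * \<eta> + 120) * (\<Delta> + \<sigma> * ln W * sqrt (ln (real T) + h) + L * ln W)"
    by (simp only: distrib_left y_def ac_simps)
  finally have factor: "2 * \<Delta> / \<eta> + 8 * m + (2 * L * \<eta> + 16 * m) * ln (B / b0)
      \<le> (2 / \<eta> + 4 * \<eta> + 120) * (\<Delta> + \<sigma> * ln W * sqrt (ln (real T) + h) + L * ln W)" .
  have "B + m \<le> (K + 3) * Z" using B(2) mZ unfolding K_def by (simp add: distrib_right)
  also have "\<dots> \<le> (K + 3) * W" using ZW K by (intro mult_left_mono) auto
  finally have "2 * (B + m) \<le> 2 * ((K + 3) * W)" by (rule mult_left_mono) simp
  then have Bm: "2 * (B + m) \<le> 2 * (K + 3) * W" by (simp only: mult.assoc)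
  show ?thesis
    unfolding K_def[symmetric]
  proof (rule mult_mono[OF Bm factor])
    show "0 \<le> 2 * (K + 3) * W" using K W3 by simp
    show "0 \<le> 2 * \<Delta> / \<eta> + 8 * m + (2 * L * \<eta> + 16 * m) * ln (B / b0)"
      using \<Delta> eta m0 L lnB0 by simp
  qed
qed

end

section \<open>The bound with high probability\<close>

context adagrad_oracle
begin

text \<open>
  For \<open>T = 1\<close> and \<open>\<delta>\<close> near \<open>1\<close> the factor \<open>sqrt (ln (T / \<delta>))\<close> is too small to bound any noise, but
  there the only gradient is that at the starting point, and \<open>gradient_sq_le_gap\<close> bounds it
  without any randomness.
\<close>

lemma gradient_sum_whp:
  assumes T: "T \<ge> 1" and \<delta>: "0 < \<delta>" "\<delta> < 1"
  defines "\<Delta> \<equiv> f x1 - fstar"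
  defines "W \<equiv> \<sigma> * sqrt (real T) + r_term (2 * (step_size_const \<eta> b0 / b0) + 6) \<Delta> L \<sigma> \<delta>"
  shows "\<exists>A\<in>sets (samples T). 1 - \<delta> \<le> measure (samples T) A \<and> (\<forall>z\<in>A.
      (\<Sum>t<T. (grad_norm t z)\<^sup>2) \<le> 2 * (step_size_const \<eta> b0 + 3) * W *
        ((2 / \<eta> + 4 * \<eta> + 120) * (\<Delta> + \<sigma> * ln W * sqrt (ln (real T / \<delta>)) + L * ln W)))"
proof (cases "T = 1")
  case False
  then have T2: "T \<ge> 2" using T by simp
  define h where "h = ln (1 / \<delta>)"
  define m where "m = \<sigma> * sqrt (1 + ln 4 + ln (real T) + h)"
  have h0: "h > 0" using \<delta> by (simp add: h_def)
  have \<Delta>0: "\<Delta> \<ge> 0" using lower[OF x1_Rd] by (simp add: \<Delta>_def)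
  interpret sc: scale_terms \<eta> b0 L \<sigma> h \<Delta> T
    by standard (use eta_pos b0_pos L_nonneg sigma_pos h0 \<Delta>0 T in auto)
  have ln_T\<delta>: "ln (real T / \<delta>) = ln (real T) + h" using T \<delta> by (simp add: h_def ln_div)
  have "0 \<le> ln (real T)" using T by simp
  moreover have "0 \<le> ln (4 :: real)" by simp
  ultimately have "0 < 1 + ln 4 + ln (real T) + h" using h0 by linarith
  then have m0: "m > 0" unfolding m_def using sigma_pos by simp
  obtain A where A: "A \<in> sets (samples T)" "1 - \<delta> \<le> measure (samples T) A"
    and good: "\<And>z. z \<in> A \<Longrightarrow> (\<Sum>t<T. (noise_norm t z)\<^sup>2) \<le> \<sigma>\<^sup>2 * (real T + (h + ln 4))"
      "\<And>z k. z \<in> A \<Longrightarrow> k \<le> T \<Longrightarrow>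
        b0\<^sup>2 + (\<Sum>t<k. (grad_norm t z)\<^sup>2) / 2 + (\<Sum>t<k. (noise_norm t z)\<^sup>2) \<le> (B k z)\<^sup>2 + 8 * \<sigma>\<^sup>2 * (h + ln 4)"
      "\<And>z t. z \<in> A \<Longrightarrow> t < T \<Longrightarrow> noise_norm t z \<le> m"
      "\<And>z. z \<in> A \<Longrightarrow> - (\<Sum>t<T. inner_noise t z / sqrt ((B t z)\<^sup>2 + (grad_norm t z)\<^sup>2 + m\<^sup>2))
        \<le> (\<Sum>t<T. (grad_norm t z)\<^sup>2 / sqrt ((B t z)\<^sup>2 + (grad_norm t z)\<^sup>2 + m\<^sup>2)) / 4 + 4 * m"
    using good_event[OF T \<delta>] unfolding h_def[symmetric] m_def[symmetric] by blast
  show ?thesis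
  proof (intro bexI[OF _ A(1)] conjI A(2) ballI)
    fix z assume z: "z \<in> A"
    interpret path: adagrad_path \<eta> L b0 "\<lambda>t. grad_norm t z" "\<lambda>t. answer_norm t z" "\<lambda>t. noise_norm t z"
      "\<lambda>t. inner_noise t z" "\<lambda>t. f (X t z) - fstar" "\<lambda>t. B t z" by (rule path)
    have gap: "f (X 0 z) - fstar = \<Delta>" by (simp add: X_0 \<Delta>_def)
    define J where "J = 8 * \<sigma>\<^sup>2 * (h + ln 4)"
    have J0: "J \<ge> 0" unfolding J_def using h0 by simp
    have implicit: "B T z \<le> b0 + sqrt J + 3 * sqrt (b0\<^sup>2 + (\<Sum>t<T. (noise_norm t z)\<^sup>2))
        + 2 * min (2 * sqrt (real T * J)) (J / (2 * b0)) + 2 * \<Delta> / \<eta> + 2 * L * \<eta> * ln (B T z / b0)"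
      using path.step_size_implicit_bound[OF J0 good(2)[OF z, folded J_def]] unfolding gap .
    have BT: "B T z \<le> step_size_const \<eta> b0 * sc.Z"
      by (rule sc.step_size_le[OF path.b_pos J_def good(1)[OF z] implicit])
    have "(\<Sum>t<T. (grad_norm t z)\<^sup>2)
        \<le> 2 * (B T z + m) * (2 * \<Delta> / \<eta> + 8 * m + (2 * L * \<eta> + 16 * m) * ln (B T z / b0))"
      using path.gradient_sum_bound[OF m0 good(3)[OF z] good(4)[OF z]] unfolding gap .
    also have "\<dots> \<le> 2 * (step_size_const \<eta> b0 + 3) * W *
        ((2 / \<eta> + 4 * \<eta> + 120) * (\<Delta> + \<sigma> * ln W * sqrt (ln (real T) + h) + L * ln W))"
      by (rule sc.bound_in_polylog_terms[OF T2 path.b0_le BT m_def])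
        (simp add: W_def r_term_def h_def)
    finally show "(\<Sum>t<T. (grad_norm t z)\<^sup>2) \<le> 2 * (step_size_const \<eta> b0 + 3) * W *
        ((2 / \<eta> + 4 * \<eta> + 120) * (\<Delta> + \<sigma> * ln W * sqrt (ln (real T / \<delta>)) + L * ln W))"
      unfolding ln_T\<delta> .
  qed
next
  case True
  interpret N: prob_space "samples T" by (intro prob_space_PiM D_prob)
  define K where "K = step_size_const \<eta> b0"
  define R where "R = 1 + \<Delta> + \<sigma>\<^sup>2 * ln (1 / \<delta>) + L * ln L"
  have K: "K \<ge> 0" unfolding K_def step_size_const_def using eta_pos b0_pos by simp
  have \<Delta>0: "\<Delta> \<ge> 0" using lower[OF x1_Rd] by (simp add: \<Delta>_def)
  have h0: "0 \<le> \<sigma>\<^sup>2 * ln (1 / \<delta>)" using \<delta> by simp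
  have RL: "L \<le> R" "1 / 2 \<le> R"
    using le_one_plus_mult_ln[OF L_nonneg] mult_ln_ge[OF L_nonneg] \<Delta>0 h0 unfolding R_def by linarith+
  have W: "W = \<sigma> * sqrt (real T) + (2 * (K / b0) + 6) * R"
    unfolding W_def r_term_def K_def R_def ..
  have Kb: "0 \<le> K / b0" using K b0_pos by simp
  have "6 * R \<le> (2 * (K / b0) + 6) * R" using RL Kb by (intro mult_right_mono) auto
  moreover have "0 \<le> \<sigma> * sqrt (real T)" using sigma_pos by simp
  ultimately have W6: "6 * R \<le> W" unfolding W by linarith
  then have W1: "1 \<le> W" "L \<le> W" using RL L_nonneg by linarith+
  have "L * 2 \<le> W * (2 * (K + 3))" using W1 K L_nonneg by (intro mult_mono) auto
  then have first: "2 * L \<le> 2 * (K + 3) * W" by (simp only: ac_simps)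
  have "0 \<le> ln (real T / \<delta>)" using True \<delta> by (simp add: ln_div)
  then have "1 * \<Delta> \<le> (2 / \<eta> + 4 * \<eta> + 120) * (\<Delta> + \<sigma> * ln W * sqrt (ln (real T / \<delta>)) + L * ln W)"
    using W1 sigma_pos L_nonneg \<Delta>0 eta_pos by (intro mult_mono) (auto intro!: add_nonneg_nonneg)
  then have bound: "2 * L * \<Delta> \<le> 2 * (K + 3) * W *
      ((2 / \<eta> + 4 * \<eta> + 120) * (\<Delta> + \<sigma> * ln W * sqrt (ln (real T / \<delta>)) + L * ln W))"
    using first L_nonneg \<Delta>0 W1 K by (intro mult_mono) auto
  show ?thesis
  proof (intro bexI[of _ "space (samples T)"] conjI ballI)
    show "1 - \<delta> \<le> measure (samples T) (space (samples T))" using \<delta> unfolding N.prob_space by simp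
    fix z
    have "(\<Sum>t<T. (grad_norm t z)\<^sup>2) = (Rd_norm d (gradf x1))\<^sup>2"
      using True by (simp add: grad_norm_def X_0)
    also have "\<dots> \<le> 2 * L * \<Delta>"
      unfolding \<Delta>_def by (rule gradient_sq_le_gap[OF smooth x1_Rd L_nonneg lower])
    also note bound
    finally show "(\<Sum>t<T. (grad_norm t z)\<^sup>2) \<le> 2 * (step_size_const \<eta> b0 + 3) * W *
        ((2 / \<eta> + 4 * \<eta> + 120) * (\<Delta> + \<sigma> * ln W * sqrt (ln (real T / \<delta>)) + L * ln W))"
      unfolding K_def .
  qed simp
qed

lemma average_event_measurable:
  "{z \<in> space (samples T). (1 / real T) * (\<Sum>t<T. (grad_norm t z)\<^sup>2) \<le> u} \<in> sets (samples T)"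
proof -
  have [measurable]: "(\<lambda>z. \<Sum>t<T. (grad_norm t z)\<^sup>2) \<in> borel_measurable (samples T)"
    by (intro borel_measurable_sum borel_measurable_power quantities_measurable) auto
  show ?thesis by measurable
qed

lemma average_bound_whp:
  assumes T: "T \<ge> 1" and \<delta>: "0 < \<delta>" "\<delta> < 1"
  defines "\<Delta> \<equiv> f x1 - fstar"
  defines "r \<equiv> r_term (2 * (step_size_const \<eta> b0 / b0) + 6) \<Delta> L \<sigma> \<delta>"
  defines "g \<equiv> g_term (2 / \<eta> + 4 * \<eta> + 120) r (c_term 1 r \<sigma> T \<delta>) \<Delta> L \<sigma> T \<delta>"
  shows "1 - \<delta> \<le> measure (samples T) {z \<in> space (samples T).
      (1 / real T) * (\<Sum>t<T. (grad_norm t z)\<^sup>2)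
        \<le> g * (2 * (step_size_const \<eta> b0 + 3) * (\<sigma> / sqrt (real T) + r / real T))}"
proof -
  interpret N: prob_space "samples T" by (intro prob_space_PiM D_prob)
  define C where "C = 2 * (step_size_const \<eta> b0 + 3)"
  define K where "K = 2 / \<eta> + 4 * \<eta> + 120"
  define W where "W = \<sigma> * sqrt (real T) + r"
  define g0 where "g0 = K * (\<Delta> + \<sigma> * ln W * sqrt (ln (real T / \<delta>)) + L * ln W)"
  obtain A where A: "A \<in> sets (samples T)" "1 - \<delta> \<le> measure (samples T) A"
    and bound: "\<And>z. z \<in> A \<Longrightarrow> (\<Sum>t<T. (grad_norm t z)\<^sup>2) \<le> C * W * g0"
    using gradient_sum_whp[OF T \<delta>] unfolding W_def r_def C_def g0_def K_def \<Delta>_def by blast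
  have C0: "C \<ge> 0" unfolding C_def step_size_const_def using eta_pos b0_pos by simp
  have \<Delta>0: "\<Delta> \<ge> 0" using lower[OF x1_Rd] by (simp add: \<Delta>_def)
  have h0: "0 \<le> ln (1 / \<delta>)" using \<delta> by simp
  have "0 \<le> step_size_const \<eta> b0 / b0"
    unfolding step_size_const_def using eta_pos b0_pos by simp
  moreover have "0 \<le> 1 + \<Delta> + \<sigma>\<^sup>2 * ln (1 / \<delta>) + L * ln L"
    using mult_ln_ge[OF L_nonneg] \<Delta>0 mult_nonneg_nonneg[OF zero_le_power2[of \<sigma>] h0] by linarith
  ultimately have r0: "0 \<le> r" unfolding r_def r_term_def by simp
  have W0: "0 \<le> W" unfolding W_def using r0 sigma_pos by simp
  have "\<sigma> * ln W \<le> c_term 1 r \<sigma> T \<delta>"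
  proof -
    have "0 \<le> \<sigma> ^ 3 * ln (1 / \<delta>)" using sigma_pos h0 by simp
    moreover have "0 \<le> \<sigma> * ln (1 + \<sigma>\<^sup>2 * real T + \<sigma>\<^sup>2 * ln (1 / \<delta>))"
      using sigma_pos h0 by (intro mult_nonneg_nonneg ln_ge_zero) auto
    ultimately show ?thesis unfolding c_term_def W_def by simp
  qed
  moreover have "0 \<le> ln (real T / \<delta>)" using T \<delta> by (intro ln_ge_zero) simp
  ultimately have "g0 \<le> g"
    unfolding g0_def g_def g_term_def K_def[symmetric] W_def[symmetric]
    using eta_pos L_nonneg by (intro mult_left_mono add_mono mult_right_mono) (auto simp: K_def)
  then have bound': "(\<Sum>t<T. (grad_norm t z)\<^sup>2) \<le> C * W * g" if "z \<in> A" for z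
    using bound[OF that] C0 W0 by (meson mult_left_mono mult_nonneg_nonneg order_trans)
  have split: "(1 / real T) * W = \<sigma> / sqrt (real T) + r / real T"
  proof -
    have "\<sigma> * sqrt (real T) / real T = \<sigma> / sqrt (real T)"
      using T by (simp add: field_simps)
    then show ?thesis unfolding W_def by (simp add: add_divide_distrib)
  qed
  let ?E = "{z \<in> space (samples T). (1 / real T) * (\<Sum>t<T. (grad_norm t z)\<^sup>2)
        \<le> g * (C * (\<sigma> / sqrt (real T) + r / real T))}"
  have "A \<subseteq> ?E"
  proof
    fix z assume z: "z \<in> A"
    have "(1 / real T) * (\<Sum>t<T. (grad_norm t z)\<^sup>2) \<le> (1 / real T) * (C * W * g)"
      using bound'[OF z] by (intro mult_left_mono) auto
    also have "\<dots> = g * (C * ((1 / real T) * W))" by (simp only: ac_simps)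
    finally show "z \<in> ?E" using z sets.sets_into_space[OF A(1)] unfolding split by auto
  qed
  moreover have "?E \<in> sets (samples T)" by (rule average_event_measurable)
  ultimately have "measure (samples T) A \<le> measure (samples T) ?E"
    by (rule N.finite_measure_mono)
  with A(2) show ?thesis unfolding C_def by linarith
qed

end

text \<open>
  Independence of the samples says that their joint law is the product measure.
\<close>

lemma (in prob_space) iid_measure_transfer:
  assumes iid: "iid_samples M D I \<zeta>" and I: "I \<noteq> {}" and E: "E \<in> sets (\<Pi>\<^sub>M i\<in>I. D)"
  shows "measure M {\<omega> \<in> space M. (\<lambda>i\<in>I. \<zeta> i \<omega>) \<in> E} = measure (\<Pi>\<^sub>M i\<in>I. D) E"
proof -
  have indep: "indep_vars (\<lambda>_. D) \<zeta> I" and dist: "\<And>t. t \<in> I \<Longrightarrow> distr M D (\<zeta> t) = D"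
    using iid by (auto simp: iid_samples_def)
  have meas: "random_variable D (\<zeta> i)" if "i \<in> I" for i
    using indep that unfolding indep_vars_def by auto
  have "distr M (\<Pi>\<^sub>M i\<in>I. D) (\<lambda>\<omega>. \<lambda>i\<in>I. \<zeta> i \<omega>) = (\<Pi>\<^sub>M i\<in>I. distr M D (\<zeta> i))"
    using indep_vars_iff_distr_eq_PiM'[where M'="\<lambda>_. D" and X=\<zeta>, OF I meas] indep by blast
  also have "\<dots> = (\<Pi>\<^sub>M i\<in>I. D)" by (intro PiM_cong dist refl)
  finally have "measure (\<Pi>\<^sub>M i\<in>I. D) E = measure (distr M (\<Pi>\<^sub>M i\<in>I. D) (\<lambda>\<omega>. \<lambda>i\<in>I. \<zeta> i \<omega>)) E" by simp
  also have "\<dots> = measure M ((\<lambda>\<omega>. \<lambda>i\<in>I. \<zeta> i \<omega>) -` E \<inter> space M)"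
    using E meas by (intro measure_distr measurable_restrict)
  also have "(\<lambda>\<omega>. \<lambda>i\<in>I. \<zeta> i \<omega>) -` E \<inter> space M = {\<omega> \<in> space M. (\<lambda>i\<in>I. \<zeta> i \<omega>) \<in> E}" by auto
  finally show ?thesis by simp
qed

theorem theorem4p5:
  fixes \<eta> b0 :: real
  assumes "\<eta> > 0" and "b0 > 0"
  shows "\<exists>Cr Cc Cg C :: real. Cr > 0 \<and> Cc > 0 \<and> Cg > 0 \<and> C > 0 \<and>
    (\<forall>(d::nat) (L::real) (\<sigma>::real) (\<delta>::real) (T::nat)
       (f :: (nat \<Rightarrow> real) \<Rightarrow> real) (gradf :: (nat \<Rightarrow> real) \<Rightarrow> (nat \<Rightarrow> real))
       (fstar::real) (x1 :: nat \<Rightarrow> real)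
       (D :: 'z measure) (G :: (nat \<Rightarrow> real) \<Rightarrow> 'z \<Rightarrow> (nat \<Rightarrow> real))
       (M :: 'w measure) (\<zeta> :: nat \<Rightarrow> 'w \<Rightarrow> 'z) (x :: nat \<Rightarrow> 'w \<Rightarrow> (nat \<Rightarrow> real)).
       d \<ge> 1 \<longrightarrow> T \<ge> 1 \<longrightarrow> \<sigma> > 0 \<longrightarrow> 0 < \<delta> \<longrightarrow> \<delta> < 1 \<longrightarrow>
       L_smooth d L f gradf \<longrightarrow>
       (\<forall>y\<in>Rd d. fstar \<le> f y) \<longrightarrow>
       gradient_oracle d gradf \<sigma> D G \<longrightarrow>
       iid_samples M D {1..T} \<zeta> \<longrightarrow>
       x1 \<in> Rd d \<longrightarrow>
       (\<forall>\<omega>\<in>space M. adagrad_norm_run d \<eta> b0 x1 T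
          (\<lambda>t. G (x t \<omega>) (\<zeta> t \<omega>)) (\<lambda>t. x t \<omega>)) \<longrightarrow>
       (let \<Delta>\<^sub>1 = f x1 - fstar;
            r = r_term Cr \<Delta>\<^sub>1 L \<sigma> \<delta>;
            c = c_term Cc r \<sigma> T \<delta>;
            g = g_term Cg r c \<Delta>\<^sub>1 L \<sigma> T \<delta>
        in measure M {\<omega> \<in> space M.
             (1 / real T) * (\<Sum>t=1..T. (Rd_norm d (gradf (x t \<omega>)))\<^sup>2)
               \<le> g * (C * (\<sigma> / sqrt (real T) + r / real T))} \<ge> 1 - \<delta>))"
proof -
  define K where "K = step_size_const \<eta> b0"
  have K: "K > 0" unfolding K_def step_size_const_def using assms by (simp add: add_pos_nonneg)
  show ?thesis
  proof (rule exI[of _ "2 * (K / b0) + 6"], rule exI[of _ 1],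
      rule exI[of _ "2 / \<eta> + 4 * \<eta> + 120"], rule exI[of _ "2 * (K + 3)"], intro conjI allI impI)
    fix d T :: nat and L \<sigma> \<delta> fstar :: real and f :: "(nat \<Rightarrow> real) \<Rightarrow> real"
      and gradf :: "(nat \<Rightarrow> real) \<Rightarrow> (nat \<Rightarrow> real)" and x1 :: "nat \<Rightarrow> real"
      and D :: "'z measure" and G :: "(nat \<Rightarrow> real) \<Rightarrow> 'z \<Rightarrow> (nat \<Rightarrow> real)"
      and M :: "'w measure" and \<zeta> :: "nat \<Rightarrow> 'w \<Rightarrow> 'z" and x :: "nat \<Rightarrow> 'w \<Rightarrow> (nat \<Rightarrow> real)"
    assume d: "d \<ge> 1" and T: "T \<ge> 1" and \<sigma>: "\<sigma> > 0" and \<delta>: "0 < \<delta>" "\<delta> < 1"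
      and smooth: "L_smooth d L f gradf" and lower: "\<forall>y\<in>Rd d. fstar \<le> f y"
      and G: "gradient_oracle d gradf \<sigma> D G" and iid: "iid_samples M D {1..T} \<zeta>" and x1: "x1 \<in> Rd d"
      and run: "\<forall>\<omega>\<in>space M. adagrad_norm_run d \<eta> b0 x1 T
          (\<lambda>t. G (x t \<omega>) (\<zeta> t \<omega>)) (\<lambda>t. x t \<omega>)"
    interpret M: prob_space M using iid by (simp add: iid_samples_def)
    interpret alg: adagrad_oracle d L f gradf fstar D G \<sigma> \<eta> b0 x1
      by standard (use d smooth lower G \<sigma> x1 assms in auto)
    define \<Delta> where "\<Delta> = f x1 - fstar"
    define r where "r = r_term (2 * (K / b0) + 6) \<Delta> L \<sigma> \<delta>"
    define g where "g = g_term (2 / \<eta> + 4 * \<eta> + 120) r (c_term 1 r \<sigma> T \<delta>) \<Delta> L \<sigma> T \<delta>"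
    define u where "u = g * (2 * (K + 3) * (\<sigma> / sqrt (real T) + r / real T))"
    let ?\<Phi> = "\<lambda>\<omega>. \<lambda>i\<in>{1..T}. \<zeta> i \<omega>"
    let ?E = "{z \<in> space (alg.samples T). (1 / real T) * (\<Sum>t<T. (alg.grad_norm t z)\<^sup>2) \<le> u}"
    have iterate: "alg.grad_norm t (?\<Phi> \<omega>) = Rd_norm d (gradf (x (Suc t) \<omega>))"
      if "\<omega> \<in> space M" "t < T" for t \<omega>
    proof -
      have "alg.state (?\<Phi> \<omega>) t = alg.state (\<lambda>i. \<zeta> i \<omega>) t"
        using that by (intro adagrad_state_cong) auto
      also have "fst \<dots> = x (Suc t) \<omega>"
        using adagrad_run_eq_state[where x="\<lambda>t. x t \<omega>" and z="\<lambda>i. \<zeta> i \<omega>" and t=t,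
            OF bspec[OF run that(1)] assms(2)] that(2) by simp
      finally show ?thesis by (simp add: alg.grad_norm_def alg.X_def)
    qed
    have meas_E: "?E \<in> sets (alg.samples T)" by (rule alg.average_event_measurable)
    have in_space: "?\<Phi> \<omega> \<in> space (alg.samples T)" if "\<omega> \<in> space M" for \<omega>
    proof -
      have "\<zeta> i \<in> M \<rightarrow>\<^sub>M D" if "i \<in> {1..T}" for i
        using iid that unfolding iid_samples_def M.indep_vars_def by auto
      then have "\<zeta> i \<omega> \<in> space D" if "i \<in> {1..T}" for i
        using that \<open>\<omega> \<in> space M\<close> by (meson measurable_space)
      then show ?thesis by (auto simp: space_PiM)
    qed
    have "1 - \<delta> \<le> measure (alg.samples T) ?E"
      using alg.average_bound_whp[OF T \<delta>]
      unfolding K_def[symmetric] \<Delta>_def[symmetric] r_def[symmetric] g_def[symmetric] u_def[symmetric] .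
    also have "\<dots> = measure M {\<omega> \<in> space M. ?\<Phi> \<omega> \<in> ?E}"
      using M.iid_measure_transfer[OF iid _ meas_E] T by simp
    also have "{\<omega> \<in> space M. ?\<Phi> \<omega> \<in> ?E} = {\<omega> \<in> space M.
        (1 / real T) * (\<Sum>t=1..T. (Rd_norm d (gradf (x t \<omega>)))\<^sup>2) \<le> u}"
    proof (rule Collect_cong, rule conj_cong[OF refl])
      fix \<omega> assume \<omega>: "\<omega> \<in> space M"
      have "(\<Sum>t=1..T. (Rd_norm d (gradf (x t \<omega>)))\<^sup>2) = (\<Sum>t<T. (Rd_norm d (gradf (x (Suc t) \<omega>)))\<^sup>2)"
        by (rule sum.reindex_bij_witness[of _ Suc "\<lambda>t. t - 1"]) auto
      also have "\<dots> = (\<Sum>t<T. (alg.grad_norm t (?\<Phi> \<omega>))\<^sup>2)" using iterate[OF \<omega>] by simp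
      finally show "?\<Phi> \<omega> \<in> ?E \<longleftrightarrow> (1 / real T) * (\<Sum>t=1..T. (Rd_norm d (gradf (x t \<omega>)))\<^sup>2) \<le> u"
        using in_space[OF \<omega>] by simp
    qed
    finally show "let \<Delta>\<^sub>1 = f x1 - fstar;
            r = r_term (2 * (K / b0) + 6) \<Delta>\<^sub>1 L \<sigma> \<delta>;
            c = c_term 1 r \<sigma> T \<delta>;
            g = g_term (2 / \<eta> + 4 * \<eta> + 120) r c \<Delta>\<^sub>1 L \<sigma> T \<delta>
        in 1 - \<delta> \<le> measure M {\<omega> \<in> space M.
             (1 / real T) * (\<Sum>t=1..T. (Rd_norm d (gradf (x t \<omega>)))\<^sup>2)
               \<le> g * (2 * (K + 3) * (\<sigma> / sqrt (real T) + r / real T))}"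
      unfolding Let_def u_def g_def r_def \<Delta>_def .
  qed (use K assms in \<open>auto intro!: add_nonneg_pos\<close>)
qed

end
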